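(* Let $H$ be a complex Hilbert space and $J$ any (possibly infinite) set of indices. Then the following hold. (i) For all $A,B\in M_J(B(H))$: $A\,\square\, B = V^*\lambda(A)\,F\,\lambda(B)V$. (ii) For all $A,B\in M_J(B(H))$: $\|A\,\square\, B\|\le \|A\|_r\,\|B\|_c$. (iii) Let $X=(x_{ij})_{i,j\in J}$ be a matrix with entries in $B(H)$ (not assumed to define a bounded operator) and let $C\ge 0$ be a real number. Suppose that for every matrix $Y=(y_{ij})_{i,j\in J}$ with entries in $B(H)$ which is column bounded, the matrix $Z:=(x_{ij}y_{ij})_{i,j\in J}$ is bounded (i.e. $Z\in M_J(B(H))$) and its operator norm satisfies $\|Z\|\le C\|Y\|_c$. Then $X$ is row bounded and $\|X\|_r\le C$. (iv) For all $A\in M_J(B(H))$: $-\mathrm{diag}(A^*A)\le A^*\,\square\, A\le \mathrm{diag}(A^*A)$. (v) For all $\Xi,\Gamma\in \ell^2(J,\mathbb{C})\otimes H$ and all $A,B\in M_J(B(H))$: $$|\langle (A\,\square\, B)\Xi,\Gamma\rangle|\le \big\|(\mathrm{diag}(B^*B))^{1/2}\Xi\big\|\;\big\|(\mathrm{diag}(AA^* ))^{1/2}\Gamma\big\|.$$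
   Context: Let $\{\alpha_j: j\in J\}$ be the canonical orthonormal basis of $\ell^2(J,\mathbb{C})$ and $e_{ij}$ the matrix units, $e_{ij}\alpha_k=\delta_{jk}\alpha_i$. $M_J(B(H))$ denotes the set of all matrices $A=(a_{ij})_{i,j\in J}$ with entries $a_{ij}\in B(H)$ which define bounded operators on $\ell^2(J,H)=\ell^2(J,\mathbb{C})\otimes H$ (via $\langle A(\alpha_j\otimes\xi),\alpha_i\otimes\eta\rangle=\langle a_{ij}\xi,\eta\rangle$); such matrices are called bounded, $\|A\|$ is the operator norm, and products, adjoints, order and square roots are those of operators on $\ell^2(J,\mathbb{C})\otimes H$ (so $(A^* )_{ij}=a_{ji}^*$). Schur block product: $A\,\square\, B:=(a_{ij}b_{ij})_{i,j\in J}$; for $A,B\in M_J(B(H))$ it again lies in $M_J(B(H))$. Diagonal: $\mathrm{diag}(A)$ is the matrix with $\mathrm{diag}(A)_{ij}=0$ if $i\ne j$ and $\mathrm{diag}(A)_{ii}=a_{ii}$. Row and column norms, for any matrix $A=(a_{ij})_{i,j\in J}$ with entries in $B(H)$: $$\|A\|_r:=\sup_{i\in J}\Big\|\sum_{j\in J}a_{ij}a_{ij}^*\Big\|^{1/2},\qquad \|A\|_c:=\sup_{j\in J}\Big\|\sum_{i\in J}a_{ij}^*a_{ij}\Big\|^{1/2},$$ where the norm of an infinite sum of positive operators is understood as the supremum of the norms of its finite partial sums (possibly $+\infty$). $A$ is row bounded (resp. column bounded) if $\|A\|_r<\infty$ (resp. $\|A\|_c<\infty$). $\lambda$ is the $*$-representation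 of $M_J(B(H))$ on $\ell^2(J,\mathbb{C})\otimes H\otimes\ell^2(J,\mathbb{C})$ given by $\lambda(A)=A\otimes I$, i.e. $\lambda(A)$ is the strong limit, over the finite subsets $G\subseteq J$ ordered by inclusion, of $\sum_{i,j,k\in G}e_{ij}\otimes a_{ij}\otimes e_{kk}$. $V:\ell^2(J,\mathbb{C})\otimes H\to\ell^2(J,\mathbb{C})\otimes H\otimes\ell^2(J,\mathbb{C})$ is the isometry $V\big(\sum_j\alpha_j\otimes\xi_j\big)=\sum_j\alpha_j\otimes\xi_j\otimes\alpha_j$. $F$ is the flip operator on $\ell^2(J,\mathbb{C})\otimes H\otimes\ell^2(J,\mathbb{C})$: the strong limit over finite subsets $G\subseteq J$ of $\sum_{i,j\in G}e_{ij}\otimes I\otimes e_{ji}$; it is the self-adjoint unitary with $F(\alpha_i\otimes\xi\otimes\alpha_j)=\alpha_j\otimes\xi\otimes\alpha_i$. *)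

theory Defs
  imports "HOL-Analysis.Analysis"
begin

section \<open>Complex Hilbert spaces\<close>

text \<open>
  A complex inner product space is presented as a \<^class>\<open>real_inner\<close> space carrying a compatible
  complex structure: the real scalar multiplication is the restriction of the complex one and the
  real inner product is the real part of the complex one, so that the library norm is
  the usual \<open>sqrt (Re (cinner x x))\<close>.  The inner product is linear in its first argument.
\<close>

class complex_inner = real_inner +
  fixes scaleC :: "complex \<Rightarrow> 'a \<Rightarrow> 'a"  (infixr \<open>*\<^sub>C\<close> 75)
    and cinner :: "'a \<Rightarrow> 'a \<Rightarrow> complex"
  assumes scaleR_eq_scaleC: "scaleR r x = complex_of_real r *\<^sub>C x"
    and scaleC_add_right: "c *\<^sub>C (x + y) = c *\<^sub>C x + c *\<^sub>C y"
    and scaleC_add_left: "(c + d) *\<^sub>C x = c *\<^sub>C x + d *\<^sub>C x"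
    and scaleC_scaleC: "c *\<^sub>C (d *\<^sub>C x) = (c * d) *\<^sub>C x"
    and cinner_commute: "cinner x y = cnj (cinner y x)"
    and cinner_add_left: "cinner (x + y) z = cinner x z + cinner y z"
    and cinner_scaleC_left: "cinner (c *\<^sub>C x) y = c * cinner x y"
    and inner_eq_Re_cinner: "inner x y = Re (cinner x y)"

class complex_hilbert = complex_inner + complete_space

subclass (in complex_hilbert) banach ..

lemma cinner_add_right: "cinner x (y + z) = cinner x y + cinner x (z::'a::complex_inner)"
  by (metis cinner_add_left cinner_commute complex_cnj_add)

lemma cinner_scaleC_right: "cinner x (c *\<^sub>C y) = cnj c * cinner x (y::'a::complex_inner)"
  by (metis cinner_scaleC_left cinner_commute complex_cnj_mult)

lemma cinner_self: "cinner x x = complex_of_real ((norm (x::'a::complex_inner))\<^sup>2)"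
proof (rule complex_eqI)
  show "Re (cinner x x) = Re (complex_of_real ((norm x)\<^sup>2))"
    by (simp add: inner_eq_Re_cinner [symmetric] dot_square_norm)
  have "Im (cinner x x) = - Im (cinner x x)"
    using arg_cong [OF cinner_commute [of x x], of Im] by simp
  then show "Im (cinner x x) = Im (complex_of_real ((norm x)\<^sup>2))"
    by simp
qed

lemma norm_scaleC: "norm (c *\<^sub>C x) = cmod c * norm (x::'a::complex_inner)"
proof -
  have "complex_of_real ((norm (c *\<^sub>C x))\<^sup>2) = (c * cnj c) * complex_of_real ((norm x)\<^sup>2)"
    by (simp only: cinner_self [symmetric] cinner_scaleC_left cinner_scaleC_right mult_ac)
  also have "\<dots> = complex_of_real ((cmod c * norm x)\<^sup>2)"
    by (simp only: complex_mult_cnj cmod_power2 [symmetric] of_real_mult [symmetric] power_mult_distrib)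
  finally have "(norm (c *\<^sub>C x))\<^sup>2 = (cmod c * norm x)\<^sup>2"
    using of_real_eq_iff by blast
  then show ?thesis
    by (simp add: power2_eq_iff_nonneg)
qed

lemma cinner_cauchy_schwarz: "cmod (cinner x y) \<le> norm x * norm (y::'a::complex_inner)"
proof (cases "cinner x y = 0")
  case False
  define u where "u = cnj (cinner x y) / complex_of_real (cmod (cinner x y))"
  have u: "cmod u = 1"
    using False by (simp add: u_def norm_divide)
  have "u * cinner x y = complex_of_real (cmod (cinner x y))"
    using False by (simp add: u_def field_simps complex_norm_square [symmetric] power2_eq_square)
  then have "cmod (cinner x y) = inner (u *\<^sub>C x) y"
    by (simp add: inner_eq_Re_cinner cinner_scaleC_left)
  also have "\<dots> \<le> norm (u *\<^sub>C x) * norm y"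
    by (rule norm_cauchy_schwarz)
  finally show ?thesis
    by (simp add: norm_scaleC u)
qed simp


section \<open>The Hilbert space of square-summable families\<close>

text \<open>
  The type \<open>('j, 'h) ell2\<close> is the space of square-summable families in \<open>'h\<close> indexed by all of
  \<open>'j\<close>.  It serves as the concrete model of the Hilbert space tensor products:
  \<open>\<ell>\<^sup>2(J) \<otimes> H\<close> is \<open>('j, 'h) ell2\<close>, with \<open>\<alpha>\<^sub>j \<otimes> \<xi>\<close> the family supported at \<open>j\<close> with value \<open>\<xi>\<close>, and
  \<open>\<ell>\<^sup>2(J) \<otimes> H \<otimes> \<ell>\<^sup>2(J)\<close> is \<open>('j \<times> 'j, 'h) ell2\<close>, with \<open>\<alpha>\<^sub>i \<otimes> \<xi> \<otimes> \<alpha>\<^sub>k\<close> the family supported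
  at \<open>(i, k)\<close> with value \<open>\<xi>\<close>.
\<close>

typedef (overloaded) ('j, 'h::complex_inner) ell2 =
    "{f :: 'j \<Rightarrow> 'h. (\<lambda>j. (norm (f j))\<^sup>2) summable_on UNIV}"
  morphisms ell2_nth Abs_ell2
  by (rule exI [of _ "\<lambda>_. 0"]) simp

setup_lifting type_definition_ell2

lemma ell2_summable: "(\<lambda>j. (norm (ell2_nth x j))\<^sup>2) summable_on UNIV"
  using ell2_nth [of x] by simp

lemma ell2_eqI: "(\<And>j. ell2_nth x j = ell2_nth y j) \<Longrightarrow> x = y"
  by (simp add: ell2_nth_inject [symmetric] fun_eq_iff)

lemma square_summable_add:
  fixes f g :: "'j \<Rightarrow> 'h::real_normed_vector"
  assumes "(\<lambda>j. (norm (f j))\<^sup>2) summable_on UNIV" "(\<lambda>j. (norm (g j))\<^sup>2) summable_on UNIV"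
  shows "(\<lambda>j. (norm (f j + g j))\<^sup>2) summable_on UNIV"
proof (rule summable_on_comparison_test)
  show "(\<lambda>j. 2 * (norm (f j))\<^sup>2 + 2 * (norm (g j))\<^sup>2) summable_on UNIV"
    by (intro summable_on_add summable_on_cmult_right assms)
  fix j
  have "(norm (f j + g j))\<^sup>2 \<le> (norm (f j) + norm (g j))\<^sup>2"
    by (simp add: norm_triangle_ineq power_mono)
  also have "\<dots> \<le> 2 * (norm (f j))\<^sup>2 + 2 * (norm (g j))\<^sup>2"
    using sum_squares_bound [of "norm (f j)" "norm (g j)"] by (simp add: power2_sum)
  finally show "(norm (f j + g j))\<^sup>2 \<le> 2 * (norm (f j))\<^sup>2 + 2 * (norm (g j))\<^sup>2" .
qed simp

lemma square_summable_cmult: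
  fixes f g :: "'j \<Rightarrow> 'h::real_normed_vector"
  assumes "(\<lambda>j. (norm (f j))\<^sup>2) summable_on UNIV" "\<And>j. norm (g j) = c * norm (f j)"
  shows "(\<lambda>j. (norm (g j))\<^sup>2) summable_on UNIV"
  using assms by (simp add: power_mult_distrib summable_on_cmult_right)

lift_definition ell2_single :: "'j \<Rightarrow> 'h \<Rightarrow> ('j, 'h::complex_inner) ell2"
  is "\<lambda>i \<xi> j. if j = i then \<xi> else 0"
proof -
  fix i :: 'j and \<xi> :: 'h
  have "(\<lambda>j. (norm (if j = i then \<xi> else 0))\<^sup>2) summable_on {i}"
    by simp
  then show "(\<lambda>j. (norm (if j = i then \<xi> else 0))\<^sup>2) summable_on UNIV"
    by (rule summable_on_cong_neutral [THEN iffD1, rotated -1]) auto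
qed

instantiation ell2 :: (type, complex_inner) real_vector
begin

lift_definition zero_ell2 :: "('a, 'b) ell2" is "\<lambda>_. 0" by simp

lift_definition plus_ell2 :: "('a, 'b) ell2 \<Rightarrow> ('a, 'b) ell2 \<Rightarrow> ('a, 'b) ell2"
  is "\<lambda>f g j. f j + g j"
  by (rule square_summable_add)

lift_definition uminus_ell2 :: "('a, 'b) ell2 \<Rightarrow> ('a, 'b) ell2" is "\<lambda>f j. - f j"
  by simp

lift_definition minus_ell2 :: "('a, 'b) ell2 \<Rightarrow> ('a, 'b) ell2 \<Rightarrow> ('a, 'b) ell2"
  is "\<lambda>f g j. f j - g j"
  using square_summable_add [of _ "\<lambda>j. - g j" for g] by force

lift_definition scaleR_ell2 :: "real \<Rightarrow> ('a, 'b) ell2 \<Rightarrow> ('a, 'b) ell2" is "\<lambda>r f j. r *\<^sub>R f j"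
  by (erule square_summable_cmult) (rule norm_scaleR)

instance
  by standard (transfer, simp add: fun_eq_iff algebra_simps)+

end

instantiation ell2 :: (type, complex_inner) complex_inner
begin

lift_definition scaleC_ell2 :: "complex \<Rightarrow> ('a, 'b) ell2 \<Rightarrow> ('a, 'b) ell2" is "\<lambda>c f j. c *\<^sub>C f j"
  by (erule square_summable_cmult) (rule norm_scaleC)

definition cinner_ell2 :: "('a, 'b) ell2 \<Rightarrow> ('a, 'b) ell2 \<Rightarrow> complex"
  where "cinner_ell2 x y = (\<Sum>\<^sub>\<infinity>j. cinner (ell2_nth x j) (ell2_nth y j))"

definition inner_ell2 :: "('a, 'b) ell2 \<Rightarrow> ('a, 'b) ell2 \<Rightarrow> real"
  where "inner_ell2 x y = Re (cinner x y)"

definition norm_ell2 :: "('a, 'b) ell2 \<Rightarrow> real"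
  where "norm_ell2 x = sqrt (inner x x)"

definition sgn_ell2 :: "('a, 'b) ell2 \<Rightarrow> ('a, 'b) ell2"
  where "sgn_ell2 x = x /\<^sub>R norm x"

definition dist_ell2 :: "('a, 'b) ell2 \<Rightarrow> ('a, 'b) ell2 \<Rightarrow> real"
  where "dist_ell2 x y = norm (x - y)"

definition uniformity_ell2 :: "(('a, 'b) ell2 \<times> ('a, 'b) ell2) filter"
  where "uniformity_ell2 = (INF e\<in>{0 <..}. principal {(x, y). dist x y < e})"

definition open_ell2 :: "('a, 'b) ell2 set \<Rightarrow> bool"
  where "open_ell2 U \<longleftrightarrow> (\<forall>x\<in>U. \<forall>\<^sub>F (x', y) in uniformity. x' = x \<longrightarrow> y \<in> U)"

lemma cinner_ell2_summable: "(\<lambda>j. cinner (ell2_nth x j) (ell2_nth y j)) summable_on UNIV"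
  for x y :: "('a, 'b) ell2"
proof (rule abs_summable_summable, rule summable_on_comparison_test)
  show "(\<lambda>j. (norm (ell2_nth x j))\<^sup>2 + (norm (ell2_nth y j))\<^sup>2) summable_on UNIV"
    by (intro summable_on_add ell2_summable)
  fix j
  have "cmod (cinner (ell2_nth x j) (ell2_nth y j)) \<le> norm (ell2_nth x j) * norm (ell2_nth y j)"
    by (rule cinner_cauchy_schwarz)
  also have "\<dots> \<le> (norm (ell2_nth x j))\<^sup>2 + (norm (ell2_nth y j))\<^sup>2"
    using sum_squares_bound [of "norm (ell2_nth x j)" "norm (ell2_nth y j)"]
      mult_nonneg_nonneg [of "norm (ell2_nth x j)" "norm (ell2_nth y j)"]
    by (simp del: mult_nonneg_nonneg)
  finally show "norm (cinner (ell2_nth x j) (ell2_nth y j)) \<le> (norm (ell2_nth x j))\<^sup>2 + (norm (ell2_nth y j))\<^sup>2" .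
qed simp

lemma inner_ell2_self: "inner x x = (\<Sum>\<^sub>\<infinity>j. (norm (ell2_nth x j))\<^sup>2)"
  for x :: "('a, 'b) ell2"
  unfolding inner_ell2_def cinner_ell2_def infsum_Re [OF cinner_ell2_summable, symmetric]
  by (simp add: cinner_self)

instance
proof
  fix x y z :: "('a, 'b) ell2" and r :: real and c d :: complex
  show "dist x y = norm (x - y)" by (rule dist_ell2_def)
  show "sgn x = x /\<^sub>R norm x" by (rule sgn_ell2_def)
  show "uniformity = (INF e\<in>{0 <..}. principal {(x::('a, 'b) ell2, y). dist x y < e})"
    by (rule uniformity_ell2_def)
  show "open U \<longleftrightarrow> (\<forall>x\<in>U. \<forall>\<^sub>F (x', y) in uniformity. x' = x \<longrightarrow> y \<in> U)" for U :: "('a, 'b) ell2 set"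
    by (rule open_ell2_def)
  show "r *\<^sub>R x = complex_of_real r *\<^sub>C x"
    by (transfer, simp add: scaleR_eq_scaleC)
  show "c *\<^sub>C (x + y) = c *\<^sub>C x + c *\<^sub>C y" "(c + d) *\<^sub>C x = c *\<^sub>C x + d *\<^sub>C x"
    "c *\<^sub>C (d *\<^sub>C x) = (c * d) *\<^sub>C x"
    by (transfer, simp add: scaleC_add_right scaleC_add_left scaleC_scaleC)+
  show ccom: "cinner x y = cnj (cinner y x)" for x y :: "('a, 'b) ell2"
    unfolding cinner_ell2_def by (subst infsum_cnj [symmetric]) (metis cinner_commute)
  show cadd: "cinner (x + y) z = cinner x z + cinner y z"
    unfolding cinner_ell2_def
    by (simp add: plus_ell2.rep_eq cinner_add_left infsum_add cinner_ell2_summable)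
  show cscale: "cinner (c *\<^sub>C x) y = c * cinner x y" for c
    unfolding cinner_ell2_def
    by (simp add: scaleC_ell2.rep_eq cinner_scaleC_left infsum_cmult_right cinner_ell2_summable)
  show "inner x y = Re (cinner x y)" by (rule inner_ell2_def)
  show "inner x y = inner y x"
    using ccom [of x y] by (simp add: inner_ell2_def)
  show "inner (x + y) z = inner x z + inner y z"
    by (simp add: inner_ell2_def cadd)
  have "r *\<^sub>R x = complex_of_real r *\<^sub>C x"
    by (transfer, simp add: scaleR_eq_scaleC)
  then show "inner (r *\<^sub>R x) y = r * inner x y"
    by (simp add: inner_ell2_def cscale)
  show "0 \<le> inner x x"
    by (simp add: inner_ell2_self infsum_nonneg)
  show "inner x x = 0 \<longleftrightarrow> x = 0"
  proof
    assume "inner x x = 0"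
    then have "(norm (ell2_nth x j))\<^sup>2 = 0" for j
      by (intro nonneg_infsum_le_0D [where A = UNIV]) (auto simp: inner_ell2_self ell2_summable)
    then show "x = 0"
      by (intro ell2_eqI) (simp add: zero_ell2.rep_eq)
  qed (simp add: inner_ell2_self zero_ell2.rep_eq)
  show "norm x = sqrt (inner x x)" by (rule norm_ell2_def)
qed

end

lemma norm_ell2_square: "(norm x)\<^sup>2 = (\<Sum>\<^sub>\<infinity>j. (norm (ell2_nth x j))\<^sup>2)"
  by (simp add: dot_square_norm [symmetric] inner_ell2_self)

lemma ell2_finite_sum_le: "finite F \<Longrightarrow> (\<Sum>j\<in>F. (norm (ell2_nth x j))\<^sup>2) \<le> (norm x)\<^sup>2"
  unfolding norm_ell2_square by (rule finite_sum_le_infsum) (auto simp: ell2_summable)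

lemma norm_ell2_nth_le: "norm (ell2_nth x j) \<le> norm x"
  using ell2_finite_sum_le [of "{j}" x] by (auto simp: power_mono_iff)

instance ell2 :: (type, complex_hilbert) complex_hilbert
proof
  fix X :: "nat \<Rightarrow> ('a, 'b) ell2"
  assume X: "Cauchy X"
  have "Cauchy (\<lambda>n. ell2_nth (X n) j)" for j
  proof (rule CauchyI)
    fix e :: real assume "0 < e"
    then obtain M where M: "\<And>m n. m \<ge> M \<Longrightarrow> n \<ge> M \<Longrightarrow> norm (X m - X n) < e"
      using X CauchyD by blast
    have "norm (ell2_nth (X m) j - ell2_nth (X n) j) < e" if "m \<ge> M" "n \<ge> M" for m n
      using norm_ell2_nth_le [of "X m - X n" j] M [OF that] by (simp add: minus_ell2.rep_eq)
    then show "\<exists>M. \<forall>m\<ge>M. \<forall>n\<ge>M. norm (ell2_nth (X m) j - ell2_nth (X n) j) < e"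
      by blast
  qed
  then have "\<forall>j. \<exists>l. (\<lambda>n. ell2_nth (X n) j) \<longlonglongrightarrow> l"
    by (simp add: Cauchy_convergent_iff convergent_def)
  then obtain l where l: "\<And>j. (\<lambda>n. ell2_nth (X n) j) \<longlonglongrightarrow> l j"
    by metis
  have bound: "(\<Sum>j\<in>F. (norm (ell2_nth (X m) j - l j))\<^sup>2) \<le> e\<^sup>2"
    if "finite F" and e: "\<And>n. n \<ge> M \<Longrightarrow> norm (X m - X n) \<le> e" for F m M e
  proof (rule LIMSEQ_le_const2)
    show "(\<lambda>n. \<Sum>j\<in>F. (norm (ell2_nth (X m) j - ell2_nth (X n) j))\<^sup>2)
            \<longlonglongrightarrow> (\<Sum>j\<in>F. (norm (ell2_nth (X m) j - l j))\<^sup>2)"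
      by (intro tendsto_intros l)
    have "(\<Sum>j\<in>F. (norm (ell2_nth (X m) j - ell2_nth (X n) j))\<^sup>2) \<le> e\<^sup>2" if "n \<ge> M" for n
    proof -
      have "(\<Sum>j\<in>F. (norm (ell2_nth (X m) j - ell2_nth (X n) j))\<^sup>2) \<le> (norm (X m - X n))\<^sup>2"
        using ell2_finite_sum_le [OF \<open>finite F\<close>, of "X m - X n"] by (simp add: minus_ell2.rep_eq)
      also have "\<dots> \<le> e\<^sup>2"
        using e [OF that] by (simp add: power_mono)
      finally show ?thesis .
    qed
    then show "\<exists>N. \<forall>n\<ge>N. (\<Sum>j\<in>F. (norm (ell2_nth (X m) j - ell2_nth (X n) j))\<^sup>2) \<le> e\<^sup>2"
      by blast
  qed
  have diff: "(\<lambda>j. (norm (ell2_nth (X m) j - l j))\<^sup>2) summable_on UNIV"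
    if "\<And>n. n \<ge> M \<Longrightarrow> norm (X m - X n) \<le> e" for m M e
  proof (rule nonneg_bdd_above_summable_on)
    show "bdd_above (sum (\<lambda>j. (norm (ell2_nth (X m) j - l j))\<^sup>2) ` {F. F \<subseteq> UNIV \<and> finite F})"
      by (rule bdd_aboveI [of _ "e\<^sup>2"]) (use bound [OF _ that] in auto)
  qed simp
  obtain M where M: "\<And>m n. m \<ge> M \<Longrightarrow> n \<ge> M \<Longrightarrow> norm (X m - X n) < 1"
    using X CauchyD [of X 1] by auto
  have "(\<lambda>j. (norm (ell2_nth (X M) j - l j))\<^sup>2) summable_on UNIV"
    by (rule diff [where e = 1 and M = M]) (use M [of M] in \<open>auto intro: less_imp_le\<close>)
  then have "(\<lambda>j. (norm (l j - ell2_nth (X M) j))\<^sup>2) summable_on UNIV"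
    by (simp add: norm_minus_commute)
  from square_summable_add [OF this ell2_summable [of "X M"]]
  have "(\<lambda>j. (norm (l j))\<^sup>2) summable_on UNIV"
    by simp
  then have nth: "ell2_nth (Abs_ell2 l) = l"
    by (simp add: Abs_ell2_inverse)
  have "X \<longlonglongrightarrow> Abs_ell2 l"
  proof (rule LIMSEQ_I)
    fix r :: real assume "0 < r"
    then obtain M where M: "\<And>m n. m \<ge> M \<Longrightarrow> n \<ge> M \<Longrightarrow> norm (X m - X n) < r / 2"
      using X CauchyD [of X "r / 2"] by auto
    have "norm (X m - Abs_ell2 l) < r" if "m \<ge> M" for m
    proof -
      have le: "norm (X m - X n) \<le> r / 2" if "n \<ge> M" for n
        using M [OF \<open>m \<ge> M\<close> that] by simp
      have "(norm (X m - Abs_ell2 l))\<^sup>2 = (\<Sum>\<^sub>\<infinity>j. (norm (ell2_nth (X m) j - l j))\<^sup>2)"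
        by (simp add: norm_ell2_square minus_ell2.rep_eq nth)
      also have "\<dots> \<le> (r / 2)\<^sup>2"
        by (rule infsum_le_finite_sums [OF diff [OF le]]) (auto intro: bound [OF _ le])
      finally have "norm (X m - Abs_ell2 l) \<le> r / 2"
        using \<open>0 < r\<close> by (simp add: power2_le_iff_abs_le)
      then show ?thesis
        using \<open>0 < r\<close> by simp
    qed
    then show "\<exists>no. \<forall>n\<ge>no. norm (X n - Abs_ell2 l) < r"
      by blast
  qed
  then show "convergent X"
    by (auto simp: convergent_def)
qed

lemma cinner_ell2_single_right: "cinner x (ell2_single i \<eta>) = cinner (ell2_nth x i) \<eta>"
proof -
  have zero: "cinner v 0 = 0" for v :: 'b
    using cinner_cauchy_schwarz [of v 0] by simp
  have "cinner x (ell2_single i \<eta>) = (\<Sum>\<^sub>\<infinity>j\<in>{i}. cinner (ell2_nth x j) (ell2_nth (ell2_single i \<eta>) j))"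
    unfolding cinner_ell2_def
    by (rule infsum_cong_neutral) (auto simp: ell2_single.rep_eq zero)
  then show ?thesis
    by (simp add: ell2_single.rep_eq)
qed


section \<open>Bounded operators\<close>

definition bounded_op :: "('a::complex_inner \<Rightarrow> 'b::complex_inner) \<Rightarrow> bool"
  where "bounded_op T \<longleftrightarrow> bounded_linear T \<and> (\<forall>c x. T (c *\<^sub>C x) = c *\<^sub>C T x)"

text \<open>
  The definite descriptions below (adjoint, square root, operator of a matrix) are meaningful for
  bounded operators on Hilbert spaces, positive operators and bounded matrices respectively.
  The order on \<^typ>\<open>complex\<close> makes \<open>0 \<le> z\<close> say that \<open>z\<close> is real and nonnegative.
\<close>

definition adjoint_op :: "('a::complex_inner \<Rightarrow> 'b::complex_inner) \<Rightarrow> 'b \<Rightarrow> 'a"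
  where "adjoint_op T = (THE S. \<forall>x y. cinner (T x) y = cinner x (S y))"

definition positive_op :: "('a::complex_inner \<Rightarrow> 'a) \<Rightarrow> bool"
  where "positive_op T \<longleftrightarrow> bounded_op T \<and> (\<forall>x. 0 \<le> cinner (T x) x)"

definition le_op :: "('a::complex_inner \<Rightarrow> 'a) \<Rightarrow> ('a \<Rightarrow> 'a) \<Rightarrow> bool"
  where "le_op S T \<longleftrightarrow> positive_op (\<lambda>x. T x - S x)"

definition sqrt_op :: "('a::complex_inner \<Rightarrow> 'a) \<Rightarrow> 'a \<Rightarrow> 'a"
  where "sqrt_op T = (THE R. positive_op R \<and> R \<circ> R = T)"

definition strong_limit :: "('j set \<Rightarrow> 'a \<Rightarrow> 'b::t2_space) \<Rightarrow> 'a \<Rightarrow> 'b"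
  where "strong_limit T x = Lim (finite_subsets_at_top UNIV) (\<lambda>G. T G x)"


section \<open>Matrices of operators\<close>

type_synonym ('j, 'h) op_matrix = "'j \<Rightarrow> 'j \<Rightarrow> 'h \<Rightarrow> 'h"

definition bounded_entries :: "('j, 'h::complex_inner) op_matrix \<Rightarrow> bool"
  where "bounded_entries A \<longleftrightarrow> (\<forall>i j. bounded_op (A i j))"

definition represents_op ::
    "('j, 'h::complex_inner) op_matrix \<Rightarrow> (('j, 'h) ell2 \<Rightarrow> ('j, 'h) ell2) \<Rightarrow> bool"
  where "represents_op A T \<longleftrightarrow> bounded_op T \<and>
    (\<forall>i j \<xi> \<eta>. cinner (T (ell2_single j \<xi>)) (ell2_single i \<eta>) = cinner (A i j \<xi>) \<eta>)"

definition bounded_matrix :: "('j, 'h::complex_inner) op_matrix \<Rightarrow> bool"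
  where "bounded_matrix A \<longleftrightarrow> bounded_entries A \<and> (\<exists>T. represents_op A T)"

definition op_of_matrix ::
    "('j, 'h::complex_inner) op_matrix \<Rightarrow> ('j, 'h) ell2 \<Rightarrow> ('j, 'h) ell2"
  where "op_of_matrix A = (THE T. represents_op A T)"

definition matrix_of_op ::
    "(('j, 'h::complex_inner) ell2 \<Rightarrow> ('j, 'h) ell2) \<Rightarrow> ('j, 'h) op_matrix"
  where "matrix_of_op T = (\<lambda>i j \<xi>. ell2_nth (T (ell2_single j \<xi>)) i)"

lemma represents_op_iff: "represents_op A T \<longleftrightarrow> bounded_op T \<and> matrix_of_op T = A"
proof -
  have eq: "(\<forall>\<eta>. cinner v \<eta> = cinner w \<eta>) \<longleftrightarrow> v = w" for v w :: 'b
  proof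
    assume "\<forall>\<eta>. cinner v \<eta> = cinner w \<eta>"
    then have "\<forall>\<eta>. inner v \<eta> = inner w \<eta>"
      by (simp add: inner_eq_Re_cinner)
    then show "v = w"
      by (simp only: vector_eq_rdot)
  qed simp
  show ?thesis
    by (auto simp: represents_op_def cinner_ell2_single_right matrix_of_op_def fun_eq_iff eq)
qed

definition schur_prod ::
    "('j, 'h) op_matrix \<Rightarrow> ('j, 'h) op_matrix \<Rightarrow> ('j, 'h) op_matrix"  (infixl \<open>\<box>\<close> 70)
  where "A \<box> B = (\<lambda>i j. A i j \<circ> B i j)"

definition matrix_prod ::
    "('j, 'h::complex_inner) op_matrix \<Rightarrow> ('j, 'h) op_matrix \<Rightarrow> ('j, 'h) op_matrix"
    (infixl \<open>\<cdot>\<^sub>M\<close> 70)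
  where "A \<cdot>\<^sub>M B = matrix_of_op (op_of_matrix A \<circ> op_of_matrix B)"

text \<open>The matrix of the Hilbert space adjoint; its \<open>(i, j)\<close> entry is the adjoint of \<open>A j i\<close>.\<close>

definition matrix_adj :: "('j, 'h::complex_inner) op_matrix \<Rightarrow> ('j, 'h) op_matrix"
  where "matrix_adj A = matrix_of_op (adjoint_op (op_of_matrix A))"

definition diag_matrix :: "('j, 'h::complex_inner) op_matrix \<Rightarrow> ('j, 'h) op_matrix"
  where "diag_matrix A = (\<lambda>i j. if i = j then A i i else (\<lambda>_. 0))"

text \<open>
  The norm of an infinite sum of positive operators is the supremum of the norms of its finite
  partial sums.  As the square root is increasing and continuous, it commutes with that supremum
  and is applied to the partial sums.
\<close>

definition row_norm :: "('j, 'h::complex_inner) op_matrix \<Rightarrow> ennreal"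
  where "row_norm A = (SUP i. SUP G\<in>{G. finite G}.
    ennreal (sqrt (onorm (\<lambda>\<xi>. \<Sum>j\<in>G. A i j (adjoint_op (A i j) \<xi>)))))"

definition col_norm :: "('j, 'h::complex_inner) op_matrix \<Rightarrow> ennreal"
  where "col_norm A = (SUP j. SUP G\<in>{G. finite G}.
    ennreal (sqrt (onorm (\<lambda>\<xi>. \<Sum>i\<in>G. adjoint_op (A i j) (A i j \<xi>)))))"


section \<open>The operators on the triple tensor product\<close>

text \<open>\<open>tensor_unit i j a k l\<close> is \<open>e\<^sub>i\<^sub>j \<otimes> a \<otimes> e\<^sub>k\<^sub>l\<close>, which maps
  \<open>\<alpha>\<^sub>j \<otimes> \<xi> \<otimes> \<alpha>\<^sub>l\<close> to \<open>\<alpha>\<^sub>i \<otimes> a \<xi> \<otimes> \<alpha>\<^sub>k\<close> and vanishes on the other basis directions.\<close>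

definition tensor_unit ::
    "'j \<Rightarrow> 'j \<Rightarrow> ('h::complex_inner \<Rightarrow> 'h) \<Rightarrow> 'j \<Rightarrow> 'j \<Rightarrow> ('j \<times> 'j, 'h) ell2 \<Rightarrow> ('j \<times> 'j, 'h) ell2"
  where "tensor_unit i j a k l \<Psi> = ell2_single (i, k) (a (ell2_nth \<Psi> (j, l)))"

definition lambda_rep ::
    "('j, 'h::complex_inner) op_matrix \<Rightarrow> ('j \<times> 'j, 'h) ell2 \<Rightarrow> ('j \<times> 'j, 'h) ell2"
  where "lambda_rep A =
    strong_limit (\<lambda>G \<Psi>. \<Sum>i\<in>G. \<Sum>j\<in>G. \<Sum>k\<in>G. tensor_unit i j (A i j) k k \<Psi>)"

definition flip_op :: "('j \<times> 'j, 'h::complex_inner) ell2 \<Rightarrow> ('j \<times> 'j, 'h) ell2"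
  where "flip_op = strong_limit (\<lambda>G \<Psi>. \<Sum>i\<in>G. \<Sum>j\<in>G. tensor_unit i j id j i \<Psi>)"

definition V_op :: "('j, 'h::complex_inner) ell2 \<Rightarrow> ('j \<times> 'j, 'h) ell2"
  where "V_op \<Xi> = (\<Sum>\<^sub>\<infinity>j. ell2_single (j, j) (ell2_nth \<Xi> j))"

end

theory Submission
  imports Defs
begin

text \<open>
  Compressing by \<open>V\<close> turns the flipped product of amplifications \<open>\<lambda>(A) F \<lambda>(B)\<close> into the Schur product,
  and \<open>V\<^sup>* \<lambda>(T) V\<close> is the diagonal of \<open>T\<close>.  Hence \<open>\<langle>(A \<box> B) \<Xi>, \<Gamma>\<rangle> = \<langle>F \<lambda>(B) V \<Xi>, \<lambda>(A\<^sup>*) V \<Gamma>\<rangle>\<close>, where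
  \<open>\<parallel>\<lambda>(B) V \<Xi>\<parallel>\<^sup>2 = \<langle>diag(B\<^sup>*B) \<Xi>, \<Xi>\<rangle> = \<Sum>\<^sub>j \<parallel>B(\<alpha>\<^sub>j \<otimes> \<Xi>\<^sub>j)\<parallel>\<^sup>2 \<le> \<parallel>B\<parallel>\<^sub>c\<^sup>2 \<parallel>\<Xi>\<parallel>\<^sup>2\<close>, and all the inequalities are instances of
  Cauchy-Schwarz.  The converse (iii) tests the multiplier on a matrix supported in one row with rank
  one entries.
\<close>

section \<open>Complex inner products\<close>

text \<open>Adjoints, square roots and operators of matrices are definite descriptions, while
  \<open>lambda_rep\<close> and \<open>flip_op\<close> are strong limits and \<open>V_op\<close> is
  an infinite sum; each must be shown to exist and be identified before it can be computed with. For
  square roots the delicate point is uniqueness, so the constructed root is also shown to commute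
  with everything that commutes with the operator. On the triple product, families are indexed by
  pairs \<open>(i, k)\<close> with \<open>k\<close> the position in the last factor. Fixing
  \<open>k\<close> turns \<open>T \<otimes> I\<close> into \<open>T\<close> acting separately on
  each slice, so its norm and adjoint come from summing over slices. In (iii) the matrix
  \<open>X\<close> need not be an operator, so neither \<open>lambda_rep X\<close> nor
  \<open>matrix_adj X\<close> is available. Only entrywise adjoints and finite parts of a single row
  are used. A test matrix living in one row has a single nonzero entry in each column, so its column
  norm stays at most 1 no matter how many entries of the row of \<open>X\<close> it probes.\<close>

lemma cinner_zero_left [simp]: "cinner 0 (y::'a::complex_inner) = 0"
  using cinner_cauchy_schwarz [of 0 y] by simp

lemma cinner_zero_right [simp]: "cinner (x::'a::complex_inner) 0 = 0"
  using cinner_cauchy_schwarz [of x 0] by simp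

lemma cinner_minus_left [simp]: "cinner (- x) (y::'a::complex_inner) = - cinner x y"
  using cinner_add_left [of "- x" x y] by (simp add: eq_neg_iff_add_eq_0)

lemma cinner_minus_right [simp]: "cinner x (- y::'a::complex_inner) = - cinner x y"
  using cinner_add_right [of x "- y" y] by (simp add: eq_neg_iff_add_eq_0)

lemma cinner_diff_left: "cinner (x - y) (z::'a::complex_inner) = cinner x z - cinner y z"
  using cinner_add_left [of x "- y" z] by simp

lemma cinner_diff_right: "cinner x (y - z::'a::complex_inner) = cinner x y - cinner x z"
  using cinner_add_right [of x y "- z"] by simp

lemma cinner_sum_left: "cinner (\<Sum>i\<in>F. f i) (y::'a::complex_inner) = (\<Sum>i\<in>F. cinner (f i) y)"
  by (induction F rule: infinite_finite_induct) (auto simp: cinner_add_left)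

lemma cinner_scaleR_left: "cinner (r *\<^sub>R x) (y::'a::complex_inner) = r * cinner x y"
  by (simp add: scaleR_eq_scaleC cinner_scaleC_left)

lemma cinner_scaleR_right: "cinner x (r *\<^sub>R y::'a::complex_inner) = r * cinner x y"
  by (simp add: scaleR_eq_scaleC cinner_scaleC_right)

lemma Im_cinner: "Im (cinner x y) = inner x (\<i> *\<^sub>C (y::'a::complex_inner))"
  by (simp add: inner_eq_Re_cinner cinner_scaleC_right)

text \<open>Lets adjoints that are found for the real inner product be lifted to the complex
  one.\<close>

lemma cinner_eq_inner: "cinner x y = Complex (inner x y) (inner x (\<i> *\<^sub>C (y::'a::complex_inner)))"
  by (simp add: complex_eq_iff Im_cinner inner_eq_Re_cinner)

lemma bounded_linear_cinner_left: "bounded_linear (\<lambda>x. cinner x (y::'a::complex_inner))"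
proof (rule bounded_linear_intro)
  show "cinner (a + b) y = cinner a y + cinner b y" for a b
    by (rule cinner_add_left)
  show "cinner (r *\<^sub>R x) y = r *\<^sub>R cinner x y" for r x
    by (simp add: scaleR_eq_scaleC cinner_scaleC_left scaleR_conv_of_real)
  show "norm (cinner x y) \<le> norm x * norm y" for x
    by (rule cinner_cauchy_schwarz)
qed

lemma cinner_eqI:
  assumes "\<And>z. cinner x z = cinner y (z::'a::complex_inner)"
  shows "x = y"
  using assms vector_eq_rdot [of x y] by (auto simp: inner_eq_Re_cinner)

text \<open>Test at \<open>z = x\<close> and cancel one factor. This is how bounds on sesquilinear
  forms become bounds on operators.\<close>

lemma norm_le_cinnerI:
  fixes x :: "'a::complex_inner"
  assumes "\<And>z. cmod (cinner x z) \<le> b * norm z" "0 \<le> b"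
  shows "norm x \<le> b"
proof (cases "x = 0")
  case False
  have "norm x * norm x \<le> b * norm x"
    using assms(1) [of x] by (simp add: cinner_self power2_eq_square norm_mult)
  then show ?thesis
    using False by simp
qed (use \<open>0 \<le> b\<close> in simp)

section \<open>Riesz representation and adjoints\<close>

lemma linear_coefficient_eq_0:
  fixes a b :: real
  assumes "\<And>t. 0 \<le> 2 * t * a + t\<^sup>2 * b" "0 \<le> b"
  shows "a = 0"
proof -
  \<comment> \<open>The value \<open>t = - s\<close> makes the quadratic equal to
    \<open>- (s^2 * (b + 2))\<close>; the summand 1 keeps the denominator positive when
    \<open>b = 0\<close>.\<close>
  define s where "s = a / (b + 1)"
  have a: "a = s * (b + 1)"
    using \<open>0 \<le> b\<close> by (simp add: s_def)
  have "0 \<le> - (s\<^sup>2 * (b + 2))"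
    using assms(1) [of "- s"] by (simp add: a algebra_simps power2_eq_square)
  then have "s = 0"
    using \<open>0 \<le> b\<close> by (smt (verit) mult_pos_pos zero_less_power2)
  then show ?thesis
    by (simp add: a)
qed

text \<open>The representing vector is the minimiser of \<open>\<parallel>x\<parallel>\<^sup>2 - 2 f x\<close>; minimising sequences are Cauchy
  by the parallelogram law.\<close>

lemma riesz_representation:
  fixes f :: "'a::{real_inner, complete_space} \<Rightarrow> real"
  assumes "bounded_linear f"
  obtains z where "\<And>x. f x = inner x z"
proof -
  interpret f: bounded_linear f by fact
  define q where "q x = (norm x)\<^sup>2 - 2 * f x" for x
  obtain K where K: "\<And>x. norm (f x) \<le> norm x * K"
    using f.bounded by blast
  have lower: "- K\<^sup>2 \<le> q x" for x
  proof -
    have "f x \<le> norm x * K"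
      using K [of x] by simp
    moreover have "0 \<le> (norm x - K)\<^sup>2"
      by simp
    ultimately show ?thesis
      by (simp add: q_def power2_diff)
  qed
  then have bdd: "bdd_below (range q)"
    by (intro bdd_belowI [of _ "- K\<^sup>2"]) auto
  define m where "m = Inf (range q)"
  have m: "m \<le> q x" for x
    unfolding m_def by (rule cInf_lower [OF _ bdd]) simp
  have "\<exists>x. q x < m + inverse (real (Suc n))" for n
    using cInf_lessD [of "range q" "m + inverse (real (Suc n))"] by (auto simp: m_def)
  then obtain X where X: "\<And>n. q (X n) < m + inverse (real (Suc n))"
    by metis
  \<comment> \<open>Parallelogram law; the linear terms of \<open>q\<close> cancel between the two
    points and their midpoint.\<close>
  have par: "(norm (x - y))\<^sup>2 = 2 * q x + 2 * q y - 4 * q ((1/2) *\<^sub>R (x + y))" for x y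
    by (simp add: q_def power2_norm_eq_inner f.scaleR f.add algebra_simps inner_commute)
  have "Cauchy X"
  proof (rule CauchyI)
    fix e :: real assume "0 < e"
    \<comment> \<open>With both values of \<open>q\<close> below \<open>m + e^2 / 4\<close> and the
      midpoint value at least \<open>m\<close>, the identity \<open>par\<close> leaves less than
      \<open>e^2\<close>.\<close>
    then obtain N where N: "inverse (real (Suc N)) < e\<^sup>2 / 4"
      using reals_Archimedean [of "e\<^sup>2 / 4"] by auto
    have "norm (X k - X l) < e" if "N \<le> k" "N \<le> l" for k l
    proof -
      have *: "q (X n) < m + e\<^sup>2 / 4" if "N \<le> n" for n
      proof -
        have "inverse (real (Suc n)) \<le> inverse (real (Suc N))"
          using that by simp
        with X [of n] N show ?thesis
          by linarith
      qed
      have "(norm (X k - X l))\<^sup>2 < e\<^sup>2"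
        unfolding par using *[OF that(1)] *[OF that(2)] m [of "(1/2) *\<^sub>R (X k + X l)"] by linarith
      then show ?thesis
        using \<open>0 < e\<close> by (simp add: power_less_imp_less_base)
    qed
    then show "\<exists>M. \<forall>m\<ge>M. \<forall>n\<ge>M. norm (X m - X n) < e"
      by blast
  qed
  then obtain z where z: "X \<longlonglongrightarrow> z"
    by (auto simp: Cauchy_convergent_iff convergent_def)
  have "(\<lambda>n. q (X n)) \<longlonglongrightarrow> q z"
    unfolding q_def by (intro tendsto_intros z f.tendsto)
  moreover have "(\<lambda>n. m + inverse (real (Suc n))) \<longlonglongrightarrow> m + 0"
    by (intro tendsto_intros LIMSEQ_inverse_real_of_nat)
  ultimately have "q z \<le> m + 0"
    by (rule LIMSEQ_le) (use X in \<open>auto intro: less_imp_le\<close>)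
  then have "q z = m"
    using m [of z] by simp
  \<comment> \<open>First variation of \<open>q\<close> at its minimiser, in direction
    \<open>x\<close>.\<close>
  have "inner x z - f x = 0" for x
  proof (rule linear_coefficient_eq_0)
    fix t :: real
    have "q z \<le> q (z + t *\<^sub>R x)"
      using m \<open>q z = m\<close> by simp
    then show "0 \<le> 2 * t * (inner x z - f x) + t\<^sup>2 * (norm x)\<^sup>2"
      by (simp add: q_def power2_norm_eq_inner f.scaleR f.add algebra_simps inner_commute power2_eq_square [of t])
  qed simp
  then show thesis
    by (intro that [of z]) simp
qed

section \<open>Algebra of bounded operators\<close>

lemma bounded_opI:
  assumes "\<And>x y. T (x + y) = T x + T y" "\<And>c x. T (c *\<^sub>C x) = c *\<^sub>C T x"
    and "\<And>x. norm (T x) \<le> K * norm x"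
  shows "bounded_op T"
  unfolding bounded_op_def
proof
  show "bounded_linear T"
    by (rule bounded_linear_intro [where K = K])
      (use assms in \<open>auto simp: scaleR_eq_scaleC mult.commute\<close>)
qed (use assms in blast)

lemma
  assumes "bounded_op T"
  shows bounded_op_bounded_linear: "bounded_linear T"
    and bounded_op_scaleC: "T (c *\<^sub>C x) = c *\<^sub>C T x"
    and bounded_op_add: "T (x + y) = T x + T y"
    and bounded_op_diff: "T (x - y) = T x - T y"
    and bounded_op_zero: "T 0 = 0"
    and bounded_op_norm_le: "norm (T x) \<le> onorm T * norm x"
    and bounded_op_onorm_nonneg: "0 \<le> onorm T"
  using assms
  by (auto simp: bounded_op_def bounded_linear.linear linear_add linear_diff linear_0 onorm onorm_pos_le)

lemma bounded_op_compose:
  assumes "bounded_op S" "bounded_op T"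
  shows "bounded_op (S \<circ> T)"
  using assms by (auto simp: bounded_op_def o_def intro: bounded_linear_compose)

lemma scaleC_zero_right [simp]: "c *\<^sub>C (0::'a::complex_inner) = 0"
  using scaleC_add_right [of c 0 "0::'a"] by simp

lemma scaleC_minus_right: "c *\<^sub>C (- x::'a::complex_inner) = - (c *\<^sub>C x)"
  using scaleC_add_right [of c x "- x"] by (simp add: minus_unique)

lemma scaleC_diff_right: "c *\<^sub>C (x - y::'a::complex_inner) = c *\<^sub>C x - c *\<^sub>C y"
  using scaleC_add_right [of c x "- y"] by (simp add: scaleC_minus_right)

lemma bounded_op_sub: "bounded_op S \<Longrightarrow> bounded_op T \<Longrightarrow> bounded_op (\<lambda>x. S x - T x)"
  by (auto simp: bounded_op_def scaleC_diff_right intro: bounded_linear_sub)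

lemma bounded_op_plus: "bounded_op S \<Longrightarrow> bounded_op T \<Longrightarrow> bounded_op (\<lambda>x. S x + T x)"
  by (auto simp: bounded_op_def scaleC_add_right intro: bounded_linear_add)

lemma scaleR_scaleC: "r *\<^sub>R c *\<^sub>C (x::'a::complex_inner) = c *\<^sub>C r *\<^sub>R x"
  by (simp add: scaleR_eq_scaleC scaleC_scaleC mult.commute)

lemma bounded_op_scaleR: "bounded_op T \<Longrightarrow> bounded_op (\<lambda>x. r *\<^sub>R T x)"
  by (auto simp: bounded_op_def scaleR_scaleC intro: bounded_linear_const_scaleR)

lemma bounded_op_ident: "bounded_op (\<lambda>x. x)"
  by (simp add: bounded_op_def)

section \<open>Uniqueness and existence of adjoints\<close>

lemma adjoint_op_eqI:
  assumes "\<And>x y. cinner (T x) y = cinner x (S y)"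
  shows "adjoint_op T = S"
  unfolding adjoint_op_def
proof (rule the_equality)
  fix S' assume "\<forall>x y. cinner (T x) y = cinner x (S' y)"
  then have "cinner (S' y) x = cinner (S y) x" for x y
    by (metis assms cinner_commute)
  then show "S' = S"
    by (intro ext cinner_eqI)
qed (use assms in blast)

context
  fixes T :: "'a::complex_hilbert \<Rightarrow> 'b::complex_inner"
  assumes T: "bounded_op T"
begin

lemma cinner_adjoint_op: "cinner (T x) y = cinner x (adjoint_op T y)"
proof -
  have "\<exists>z. \<forall>x. inner (T x) y = inner x z" for y
    using riesz_representation
      [OF bounded_linear_compose [OF bounded_linear_inner_left bounded_op_bounded_linear [OF T]]]
    by metis
  then obtain S where S: "\<And>x y. inner (T x) y = inner x (S y)"
    by metis
  \<comment> \<open>The real representation theorem controls only real parts. Moving the imaginary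
    unit across the real inner product shows that \<open>S\<close> commutes with it, which recovers
    the imaginary parts.\<close>
  have skew: "inner u (\<i> *\<^sub>C v) = - inner (\<i> *\<^sub>C u) v" for u v :: "'c::complex_inner"
    by (simp add: inner_eq_Re_cinner cinner_scaleC_right cinner_scaleC_left)
  have "inner x (S (\<i> *\<^sub>C y)) = inner x (\<i> *\<^sub>C S y)" for x y
    by (simp add: S [symmetric] skew bounded_op_scaleC [OF T])
  then have "\<And>x y. cinner (T x) y = cinner x (S y)"
    by (simp add: cinner_eq_inner S)
  moreover from this have "adjoint_op T = S"
    by (rule adjoint_op_eqI)
  ultimately show ?thesis
    by simp
qed

lemma cinner_adjoint_op': "cinner (adjoint_op T y) x = cinner y (T x)"
  by (metis cinner_adjoint_op cinner_commute)

lemma bounded_op_adjoint_op: "bounded_op (adjoint_op T)"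
proof (rule bounded_opI)
  show "adjoint_op T (x + y) = adjoint_op T x + adjoint_op T y" for x y
    by (rule cinner_eqI) (simp add: cinner_add_left cinner_adjoint_op')
  show "adjoint_op T (c *\<^sub>C x) = c *\<^sub>C adjoint_op T x" for c x
    by (rule cinner_eqI) (simp add: cinner_scaleC_left cinner_adjoint_op')
  show "norm (adjoint_op T x) \<le> onorm T * norm x" for x
  proof (cases "adjoint_op T x = 0")
    case False
    have "(norm (adjoint_op T x))\<^sup>2 = cmod (cinner (adjoint_op T x) (adjoint_op T x))"
      by (simp add: cinner_self norm_power)
    also have "\<dots> = cmod (cinner x (T (adjoint_op T x)))"
      by (simp add: cinner_adjoint_op')
    also have "\<dots> \<le> norm x * norm (T (adjoint_op T x))"
      by (rule cinner_cauchy_schwarz)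
    also have "\<dots> \<le> norm x * (onorm T * norm (adjoint_op T x))"
      by (intro mult_left_mono bounded_op_norm_le [OF T]) simp
    finally show ?thesis
      using False by (simp add: power2_eq_square mult_ac)
  qed (simp add: bounded_op_onorm_nonneg [OF T])
qed

lemma adjoint_op_adjoint_op: "adjoint_op (adjoint_op T) = T"
  by (rule adjoint_op_eqI) (rule cinner_adjoint_op')

end

section \<open>Square roots of positive operators\<close>

text \<open>Polarisation: the defect \<open>D\<close> vanishes on the diagonal because the form is
  real there, so \<open>D\<close> is antisymmetric. Replacing \<open>y\<close> by its product with
  the imaginary unit makes \<open>D\<close> symmetric as well, hence zero.\<close>

lemma positive_op_symmetric:
  assumes "positive_op T"
  shows "cinner (T x) y = cinner x (T y)"
proof -
  note T = bounded_op_add [of T] bounded_op_scaleC [of T] assms [unfolded positive_op_def]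
  define D where "D x y = cinner (T x) y - cinner x (T y)" for x y
  have D0: "D x x = 0" for x
  proof -
    have "Im (cinner (T x) x) = 0"
      using assms by (auto simp: positive_op_def less_eq_complex_def)
    moreover have "cinner x (T x) = cnj (cinner (T x) x)"
      by (rule cinner_commute)
    ultimately show ?thesis
      by (simp add: D_def complex_eq_iff)
  qed
  have anti: "D x y + D y x = 0" for x y
    using D0 [of "x + y"] D0 [of x] D0 [of y] T
    by (simp add: D_def cinner_add_left cinner_add_right algebra_simps)
  have "D x (\<i> *\<^sub>C y) + D (\<i> *\<^sub>C y) x = - \<i> * (D x y - D y x)"
    using T by (simp add: D_def cinner_scaleC_left cinner_scaleC_right algebra_simps)
  then have "D x y = D y x"
    using anti [of x "\<i> *\<^sub>C y"] by simp
  then have "D x y = 0"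
    using anti [of x y] by simp
  then show ?thesis
    by (simp add: D_def)
qed

lemma positive_op_inner_symmetric: "positive_op T \<Longrightarrow> inner (T x) y = inner x (T y)"
  by (simp add: inner_eq_Re_cinner positive_op_symmetric)

lemma positive_op_inner_nonneg: "positive_op T \<Longrightarrow> 0 \<le> inner (T x) x"
  by (simp add: inner_eq_Re_cinner positive_op_def less_eq_complex_def)

lemma positive_opI:
  assumes "bounded_op T" "\<And>x y. cinner (T x) y = cinner x (T y)" "\<And>x. 0 \<le> inner (T x) x"
  shows "positive_op T"
proof -
  have "Im (cinner (T x) x) = 0" for x
    using arg_cong [OF cinner_commute [of "T x" x], of Im] assms(2) [of x x] by simp
  then show ?thesis
    using assms by (simp add: positive_op_def less_eq_complex_def inner_eq_Re_cinner)
qed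

text \<open>From the operator identity \<open>t (t S - S\<^sup>2) = (t - S) S (t - S) + S (t - S) S\<close>.\<close>

lemma norm_square_le_inner:
  fixes S :: "'a::real_inner \<Rightarrow> 'a"
  assumes "linear S" and sym: "\<And>x y. inner (S x) y = inner x (S y)"
    and pos: "\<And>x. 0 \<le> inner (S x) x" and le: "\<And>x. inner (S x) x \<le> t * (norm x)\<^sup>2" and "0 < t"
  shows "(norm (S x))\<^sup>2 \<le> t * inner (S x) x"
proof -
  define u where "u = t *\<^sub>R x - S x"
  have "0 \<le> inner (S u) u"
    by (rule pos)
  also have "inner (S u) u = t\<^sup>2 * inner (S x) x - 2 * t * (norm (S x))\<^sup>2 + inner (S (S x)) (S x)"
    using sym [of "S x" x] \<open>linear S\<close>
    by (simp add: u_def linear_diff linear_scale inner_diff_left inner_diff_right power2_norm_eq_inner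
        power2_eq_square [of t] algebra_simps)
  finally have "t * (norm (S x))\<^sup>2 \<le> t * (t * inner (S x) x)"
    using le [of "S x"] by (simp add: power2_eq_square algebra_simps)
  then show ?thesis
    using \<open>0 < t\<close> by simp
qed

lemma positive_op_norm_square_le:
  assumes "positive_op S" "onorm S \<le> t" "0 < t"
  shows "(norm (S x))\<^sup>2 \<le> t * inner (S x) x"
proof (rule norm_square_le_inner)
  have S: "bounded_op S"
    using assms by (simp add: positive_op_def)
  show "linear S"
    using S by (simp add: bounded_op_def bounded_linear.linear)
  show "inner (S x) x \<le> t * (norm x)\<^sup>2" for x
  proof -
    have "inner (S x) x \<le> norm (S x) * norm x"
      by (rule norm_cauchy_schwarz)
    also have "\<dots> \<le> (t * norm x) * norm x"
      using bounded_op_norm_le [OF S, of x] mult_right_mono [OF assms(2) norm_ge_zero [of x]]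
      by (intro mult_right_mono) auto
    finally show ?thesis
      by (simp add: power2_eq_square)
  qed
  show "inner (S x) y = inner x (S y)" for x y
    by (rule positive_op_inner_symmetric [OF assms(1)])
  show "0 \<le> inner (S x) x" for x
    by (rule positive_op_inner_nonneg [OF assms(1)])
qed (rule assms)

text \<open>The limit \<open>Y\<close> of this iteration satisfies \<open>2 Y = X + Y\<^sup>2\<close>, that is \<open>(1 - Y)\<^sup>2 = 1 - X\<close>.
  The increments are dominated by those of the scalar iteration with \<open>X = 1\<close>, which add up to at
  most \<open>1\<close>; hence it converges in norm even if \<open>\<parallel>X\<parallel> = 1\<close>.\<close>

primrec sqrt_iter :: "('a::real_vector \<Rightarrow> 'a) \<Rightarrow> nat \<Rightarrow> 'a \<Rightarrow> 'a" where
  "sqrt_iter X 0 = (\<lambda>x. 0)"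
| "sqrt_iter X (Suc n) = (\<lambda>x. (1/2) *\<^sub>R (X x + sqrt_iter X n (sqrt_iter X n x)))"

primrec scalar_iter :: "nat \<Rightarrow> real" where
  "scalar_iter 0 = 0"
| "scalar_iter (Suc n) = (1 + (scalar_iter n)\<^sup>2) / 2"

section \<open>The scalar majorant and convergence of the iteration\<close>

lemma scalar_iter_nonneg: "0 \<le> scalar_iter n"
  by (cases n) auto

lemma scalar_iter_le_1: "scalar_iter n \<le> 1"
  by (induction n) (auto simp: scalar_iter_nonneg power_le_one)

lemma scalar_iter_Suc_ge: "scalar_iter n \<le> scalar_iter (Suc n)"
  using zero_le_power2 [of "scalar_iter n - 1"] by (simp add: power2_diff)

lemma convergent_scalar_iter: "convergent scalar_iter"
  by (rule Bseq_monoseq_convergent)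
    (auto intro!: BseqI' [of _ 1] incseq_imp_monoseq incseq_SucI
      simp: scalar_iter_nonneg scalar_iter_le_1 scalar_iter_Suc_ge simp del: scalar_iter.simps)

lemma bounded_op_sqrt_iter: "bounded_op X \<Longrightarrow> bounded_op (sqrt_iter X n)"
proof (induction n)
  case 0
  then show ?case
    by (auto intro!: bounded_opI [where K = 0])
next
  case (Suc n)
  then show ?case
    using bounded_op_compose [of "sqrt_iter X n" "sqrt_iter X n"]
    by (auto simp: o_def intro!: bounded_op_scaleR bounded_op_plus)
qed

text \<open>The iterates are polynomials in \<open>X\<close>. In the limit this gives the
  commutation property on which uniqueness of square roots rests.\<close>

lemma sqrt_iter_commute:
  assumes "bounded_op Q" "\<And>x. Q (X x) = X (Q x)"
  shows "Q (sqrt_iter X n x) = sqrt_iter X n (Q x)"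
proof -
  interpret bounded_linear Q
    using assms by (simp add: bounded_op_def)
  show ?thesis
    by (induction n arbitrary: x) (simp_all add: zero add scaleR assms)
qed

lemma sqrt_iter_symmetric:
  fixes X :: "'a::complex_inner \<Rightarrow> 'a"
  assumes "\<And>x y. cinner (X x) y = cinner x (X y)"
  shows "cinner (sqrt_iter X n x) y = cinner x (sqrt_iter X n y)"
  by (induction n arbitrary: x y)
    (simp_all add: cinner_add_left cinner_add_right cinner_scaleR_left cinner_scaleR_right assms)

context
  fixes X :: "'a::complex_inner \<Rightarrow> 'a"
  assumes X: "bounded_op X" and contr: "\<And>x. norm (X x) \<le> norm x"
begin

lemma norm_sqrt_iter_le: "norm (sqrt_iter X n x) \<le> scalar_iter n * norm x"
proof (induction n arbitrary: x)
  case (Suc n)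
  have "norm (sqrt_iter X n (sqrt_iter X n x)) \<le> scalar_iter n * norm (sqrt_iter X n x)"
    by (rule Suc)
  also have "\<dots> \<le> scalar_iter n * (scalar_iter n * norm x)"
    by (intro mult_left_mono Suc scalar_iter_nonneg)
  finally show ?case
    using norm_triangle_ineq [of "X x" "sqrt_iter X n (sqrt_iter X n x)"] contr [of x]
    by (simp add: power2_eq_square ring_distribs mult.assoc del: scaleR_right_distrib scaleR_add_right)
qed simp

lemma norm_sqrt_iter_le_norm: "norm (sqrt_iter X n x) \<le> norm x"
  using norm_sqrt_iter_le [of n x] mult_right_mono [OF scalar_iter_le_1 [of n] norm_ge_zero [of x]]
  by simp

text \<open>Induct with \<open>Z Z - Y Y = (Z - Y) Z + Y (Z - Y)\<close> for consecutive iterates.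
  The two terms are at most \<open>(t - s) t\<close> and \<open>s (t - s)\<close>, whose sum
  \<open>t^2 - s^2\<close> is twice the next scalar increment.\<close>

lemma norm_sqrt_iter_increment_le:
  "norm (sqrt_iter X (Suc n) x - sqrt_iter X n x) \<le> (scalar_iter (Suc n) - scalar_iter n) * norm x"
proof (induction n arbitrary: x)
  case 0
  then show ?case
    using contr [of x] by simp
next
  case (Suc n)
  define Y where "Y = sqrt_iter X n"
  define Z where "Z = sqrt_iter X (Suc n)"
  define s where "s = scalar_iter n"
  define t where "t = scalar_iter (Suc n)"
  have st: "0 \<le> s" "s \<le> t"
    using scalar_iter_nonneg scalar_iter_Suc_ge by (simp_all only: s_def t_def)
  have IH: "norm (Z x - Y x) \<le> (t - s) * norm x" for x
    unfolding Z_def Y_def s_def t_def by (rule Suc)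
  have Y: "norm (Y x) \<le> s * norm x" and Z: "norm (Z x) \<le> t * norm x" for x
    unfolding Y_def Z_def s_def t_def by (rule norm_sqrt_iter_le)+
  have "Y (Z x - Y x) = Y (Z x) - Y (Y x)"
    unfolding Y_def by (rule bounded_op_diff [OF bounded_op_sqrt_iter [OF X]])
  then have "Z (Z x) - Y (Y x) = (Z (Z x) - Y (Z x)) + Y (Z x - Y x)"
    by simp
  also have "norm \<dots> \<le> norm (Z (Z x) - Y (Z x)) + norm (Y (Z x - Y x))"
    by (rule norm_triangle_ineq)
  also have "\<dots> \<le> (t - s) * (t * norm x) + s * ((t - s) * norm x)"
    using st by (intro add_mono order_trans [OF IH] order_trans [OF Y] mult_left_mono IH Z) auto
  finally have "norm (Z (Z x) - Y (Y x)) \<le> (t\<^sup>2 - s\<^sup>2) * norm x"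
    by (simp add: power2_eq_square algebra_simps)
  moreover have "sqrt_iter X (Suc (Suc n)) x - sqrt_iter X (Suc n) x = (1/2) *\<^sub>R (Z (Z x) - Y (Y x))"
  proof -
    have "sqrt_iter X (Suc (Suc n)) x = (1/2) *\<^sub>R (X x + Z (Z x))"
      by (simp only: sqrt_iter.simps(2) [of X "Suc n"] Z_def)
    moreover have "sqrt_iter X (Suc n) x = (1/2) *\<^sub>R (X x + Y (Y x))"
      by (simp add: Y_def)
    ultimately show ?thesis
      by (simp add: algebra_simps)
  qed
  moreover have "scalar_iter (Suc (Suc n)) - scalar_iter (Suc n) = (t\<^sup>2 - s\<^sup>2) / 2"
  proof -
    have "scalar_iter (Suc (Suc n)) = (1 + t\<^sup>2) / 2"
      by (simp only: scalar_iter.simps(2) [of "Suc n"] t_def)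
    moreover have "scalar_iter (Suc n) = (1 + s\<^sup>2) / 2"
      by (simp add: s_def)
    ultimately show ?thesis
      by (simp add: field_simps)
  qed
  ultimately show ?case
    by (simp only: norm_scaleR)
qed

lemma norm_sqrt_iter_diff_le:
  assumes "m \<le> n"
  shows "norm (sqrt_iter X n x - sqrt_iter X m x) \<le> (scalar_iter n - scalar_iter m) * norm x"
  using assms
proof (induction n rule: dec_induct)
  case (step n)
  have "norm (sqrt_iter X (Suc n) x - sqrt_iter X m x)
      \<le> norm (sqrt_iter X (Suc n) x - sqrt_iter X n x) + norm (sqrt_iter X n x - sqrt_iter X m x)"
    using norm_triangle_ineq [of "sqrt_iter X (Suc n) x - sqrt_iter X n x"
        "sqrt_iter X n x - sqrt_iter X m x"] by simp
  also have "\<dots> \<le> (scalar_iter (Suc n) - scalar_iter n) * norm x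
      + (scalar_iter n - scalar_iter m) * norm x"
    by (intro add_mono norm_sqrt_iter_increment_le step)
  finally show ?case
    by (simp only: ring_distribs)
qed simp

lemma Cauchy_sqrt_iter: "Cauchy (\<lambda>n. sqrt_iter X n x)"
proof (rule CauchyI)
  fix e :: real assume "0 < e"
  then have "0 < e / (norm x + 1)"
    by (simp add: add_nonneg_pos)
  moreover have "Cauchy scalar_iter"
    using convergent_scalar_iter by (rule convergent_Cauchy)
  ultimately obtain M
    where M: "\<And>m n. M \<le> m \<Longrightarrow> M \<le> n \<Longrightarrow> norm (scalar_iter m - scalar_iter n) < e / (norm x + 1)"
    using CauchyD by blast
  have *: "norm (sqrt_iter X n x - sqrt_iter X m x) < e" if "M \<le> m" "m \<le> n" for m n
  proof -
    have "scalar_iter n - scalar_iter m < e / (norm x + 1)"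
      using M [of n m] that by simp
    then have "(scalar_iter n - scalar_iter m) * norm x \<le> e / (norm x + 1) * norm x"
      by (intro mult_right_mono) auto
    also have "\<dots> < e"
      using \<open>0 < e\<close> add_nonneg_pos [OF norm_ge_zero [of x] zero_less_one]
      by (simp add: divide_simps distrib_left)
    finally show ?thesis
      using norm_sqrt_iter_diff_le [OF \<open>m \<le> n\<close>, of x] by linarith
  qed
  have "norm (sqrt_iter X m x - sqrt_iter X n x) < e" if "M \<le> m" "M \<le> n" for m n
    using * [of m n] * [of n m] that by (cases "m \<le> n") (auto simp: norm_minus_commute)
  then show "\<exists>M. \<forall>m\<ge>M. \<forall>n\<ge>M. norm (sqrt_iter X m x - sqrt_iter X n x) < e"
    by blast
qed

end

section \<open>Existence and uniqueness of positive square roots\<close>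

lemma positive_sqrt_of_contraction:
  fixes X :: "'a::complex_hilbert \<Rightarrow> 'a"
  assumes X: "bounded_op X" and contr: "\<And>x. norm (X x) \<le> norm x"
    and sym: "\<And>x y. cinner (X x) y = cinner x (X y)"
  obtains R where "positive_op R" "\<And>x. R (R x) = x - X x"
    "\<And>Q x. bounded_op Q \<Longrightarrow> (\<And>x. Q (X x) = X (Q x)) \<Longrightarrow> Q (R x) = R (Q x)"
proof -
  have "\<exists>l. (\<lambda>n. sqrt_iter X n x) \<longlonglongrightarrow> l" for x
    using Cauchy_sqrt_iter [OF X contr] by (simp add: Cauchy_convergent_iff convergent_def)
  then obtain Y where Y: "\<And>x. (\<lambda>n. sqrt_iter X n x) \<longlonglongrightarrow> Y x"
    by metis
  note iter = bounded_op_sqrt_iter [OF X]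
  have Y_norm: "norm (Y x) \<le> norm x" for x
    by (rule LIMSEQ_le_const2 [OF tendsto_norm [OF Y]]) (use norm_sqrt_iter_le_norm [OF X contr] in blast)
  have Y_sym: "cinner (Y x) y = cinner x (Y y)" for x y
  proof (rule LIMSEQ_unique)
    show "(\<lambda>n. cinner (sqrt_iter X n x) y) \<longlonglongrightarrow> cinner (Y x) y" for x y
      by (rule bounded_linear.tendsto [OF bounded_linear_cinner_left Y])
    from tendsto_cnj [OF this [of y x]]
    show "(\<lambda>n. cinner (sqrt_iter X n x) y) \<longlonglongrightarrow> cinner x (Y y)"
      by (simp add: sqrt_iter_symmetric [OF sym] cinner_commute [symmetric])
  qed
  \<comment> \<open>Linearity of the pointwise limit is obtained by moving \<open>Y\<close> to the
    other argument with \<open>Y_sym\<close>.\<close>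
  have Y_op: "bounded_op Y"
  proof (rule bounded_opI [where K = 1])
    show "Y (x + y) = Y x + Y y" for x y
      by (rule cinner_eqI) (simp add: Y_sym cinner_add_left)
    show "Y (c *\<^sub>C x) = c *\<^sub>C Y x" for c x
      by (rule cinner_eqI) (simp add: Y_sym cinner_scaleC_left)
  qed (simp add: Y_norm)
  \<comment> \<open>Both the operator and its argument vary with \<open>n\<close>. As the iterates
    are contractions, replacing the inner argument by \<open>Y x\<close> costs an error tending to
    0.\<close>
  have YY: "(\<lambda>n. sqrt_iter X n (sqrt_iter X n x)) \<longlonglongrightarrow> Y (Y x)" for x
  proof -
    have "(\<lambda>n. sqrt_iter X n (sqrt_iter X n x - Y x)) \<longlonglongrightarrow> 0"
    proof (rule Lim_null_comparison)
      show "\<forall>\<^sub>F n in sequentially.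
          norm (sqrt_iter X n (sqrt_iter X n x - Y x)) \<le> norm (sqrt_iter X n x - Y x)"
        by (simp add: norm_sqrt_iter_le_norm [OF X contr])
      show "(\<lambda>n. norm (sqrt_iter X n x - Y x)) \<longlonglongrightarrow> 0"
        using Y [of x] by (simp add: LIM_zero tendsto_norm_zero)
    qed
    from tendsto_add [OF this Y [of "Y x"]] show ?thesis
      by (simp add: bounded_op_diff [OF iter])
  qed
  have fixp: "2 *\<^sub>R Y x = X x + Y (Y x)" for x
  proof -
    have "(\<lambda>n. sqrt_iter X (Suc n) x) \<longlonglongrightarrow> (1/2) *\<^sub>R (X x + Y (Y x))"
      unfolding sqrt_iter.simps by (intro tendsto_intros YY)
    then have "Y x = (1/2) *\<^sub>R (X x + Y (Y x))"
      using LIMSEQ_Suc [OF Y [of x]] LIMSEQ_unique by blast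
    from arg_cong [OF this, of "scaleR 2"] show ?thesis
      by simp
  qed
  show thesis
  proof (rule that [of "\<lambda>x. x - Y x"])
    show "positive_op (\<lambda>x. x - Y x)"
    proof (rule positive_opI)
      show "bounded_op (\<lambda>x. x - Y x)"
        by (intro bounded_op_sub bounded_op_ident Y_op)
      show "cinner (x - Y x) y = cinner x (y - Y y)" for x y
        by (simp add: cinner_diff_left cinner_diff_right Y_sym)
      show "0 \<le> inner (x - Y x) x" for x
      proof -
        have "inner (Y x) x \<le> norm (Y x) * norm x"
          by (rule norm_cauchy_schwarz)
        also have "\<dots> \<le> norm x * norm x"
          by (intro mult_right_mono Y_norm) simp
        finally show ?thesis
          by (simp add: inner_diff_left dot_square_norm power2_eq_square)
      qed
    qed
    show "x - Y x - Y (x - Y x) = x - X x" for x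
      using fixp [of x] by (simp add: bounded_op_diff [OF Y_op] scaleR_2 algebra_simps)
    show "Q (x - Y x) = Q x - Y (Q x)" if Q: "bounded_op Q" "\<And>x. Q (X x) = X (Q x)" for Q x
    proof -
      have "(\<lambda>n. Q (sqrt_iter X n x)) \<longlonglongrightarrow> Q (Y x)"
        by (rule bounded_linear.tendsto [OF bounded_op_bounded_linear [OF Q(1)] Y])
      then have "(\<lambda>n. sqrt_iter X n (Q x)) \<longlonglongrightarrow> Q (Y x)"
        by (simp only: sqrt_iter_commute [of Q X, OF Q])
      then have "Q (Y x) = Y (Q x)"
        using Y LIMSEQ_unique by blast
      then show ?thesis
        by (simp add: bounded_op_diff [OF Q(1)])
    qed
  qed
qed

text \<open>Rescale: \<open>X = 1 - T / t\<close> is a symmetric contraction, and a root of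
  \<open>1 - X = T / t\<close> times \<open>sqrt t\<close> is a root of \<open>T\<close>. Whatever
  commutes with \<open>T\<close> commutes with \<open>X\<close>.\<close>

lemma positive_sqrt_exists:
  fixes T :: "'a::complex_hilbert \<Rightarrow> 'a"
  assumes T: "positive_op T"
  obtains R where "positive_op R" "\<And>x. R (R x) = T x"
    "\<And>Q x. bounded_op Q \<Longrightarrow> (\<And>x. Q (T x) = T (Q x)) \<Longrightarrow> Q (R x) = R (Q x)"
proof -
  have T_op: "bounded_op T"
    using T by (simp add: positive_op_def)
  \<comment> \<open>The summand 1 makes \<open>t\<close> positive even for
    \<open>T = 0\<close>.\<close>
  define t where "t = onorm T + 1"
  have t: "0 < t" "onorm T \<le> t"
    using bounded_op_onorm_nonneg [OF T_op] by (auto simp: t_def)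
  define X where "X x = x - (1/t) *\<^sub>R T x" for x
  have X_op: "bounded_op X"
    unfolding X_def by (intro bounded_op_sub bounded_op_scaleR bounded_op_ident T_op)
  have contr: "norm (X x) \<le> norm x" for x
  proof (rule power2_le_imp_le)
    \<comment> \<open>In the expanded square, the last term is at most
      \<open>inner (T x) x / t\<close>, half of what the middle term subtracts.\<close>
    have "(norm (X x))\<^sup>2 = (norm x)\<^sup>2 - (2/t) * inner (T x) x + (1/t)\<^sup>2 * (norm (T x))\<^sup>2"
      unfolding X_def power2_norm_eq_inner
      by (simp add: inner_diff_left inner_diff_right inner_commute power2_eq_square algebra_simps)
    also have "(1/t)\<^sup>2 * (norm (T x))\<^sup>2 \<le> (1/t)\<^sup>2 * (t * inner (T x) x)"
      by (intro mult_left_mono positive_op_norm_square_le T t) simp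
    also have "(norm x)\<^sup>2 - (2/t) * inner (T x) x + (1/t)\<^sup>2 * (t * inner (T x) x)
        = (norm x)\<^sup>2 - inner (T x) x / t"
      using t by (simp add: field_simps power2_eq_square)
    also have "\<dots> \<le> (norm x)\<^sup>2"
      using positive_op_inner_nonneg [OF T, of x] t by simp
    finally show "(norm (X x))\<^sup>2 \<le> (norm x)\<^sup>2"
      by simp
  qed simp
  have sym: "cinner (X x) y = cinner x (X y)" for x y
    by (simp add: X_def cinner_diff_left cinner_diff_right cinner_scaleR_left cinner_scaleR_right
        positive_op_symmetric [OF T])
  obtain R where R: "positive_op R" "\<And>x. R (R x) = x - X x"
      "\<And>Q x. bounded_op Q \<Longrightarrow> (\<And>x. Q (X x) = X (Q x)) \<Longrightarrow> Q (R x) = R (Q x)"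
    using positive_sqrt_of_contraction [OF X_op contr sym] by blast
  have R_op: "bounded_op R"
    using R by (simp add: positive_op_def)
  have scale: "S (r *\<^sub>R x) = r *\<^sub>R S x" if "bounded_op S" for S :: "'a \<Rightarrow> 'a" and r x
    using that by (simp add: bounded_op_def bounded_linear.linear linear_scale)
  show thesis
  proof (rule that [of "\<lambda>x. sqrt t *\<^sub>R R x"])
    show "positive_op (\<lambda>x. sqrt t *\<^sub>R R x)"
      using t positive_op_inner_nonneg [OF R(1)]
      by (intro positive_opI bounded_op_scaleR R_op)
        (auto simp: cinner_scaleR_left cinner_scaleR_right positive_op_symmetric [OF R(1)])
    show "sqrt t *\<^sub>R R (sqrt t *\<^sub>R R x) = T x" for x
      using t by (simp add: scale [OF R_op] R(2) X_def)
    show "Q (sqrt t *\<^sub>R R x) = sqrt t *\<^sub>R R (Q x)"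
      if Q: "bounded_op Q" "\<And>x. Q (T x) = T (Q x)" for Q x
    proof -
      have "Q (X x) = X (Q x)" for x
        by (simp add: X_def bounded_op_diff [OF Q(1)] scale [OF Q(1)] Q(2))
      then show ?thesis
        by (simp add: scale [OF Q(1)] R(3) [OF Q(1)])
    qed
  qed
qed

lemma positive_op_eq_0:
  assumes "positive_op S" "inner (S x) x = 0"
  shows "S x = 0"
proof -
  have "0 \<le> onorm S"
    using assms by (simp add: positive_op_def bounded_op_onorm_nonneg)
  then show ?thesis
    using positive_op_norm_square_le [OF assms(1), of "onorm S + 1" x] assms(2) by simp
qed

text \<open>Commuting roots satisfy \<open>(S + R) (S - R) = 0\<close>. Hence for
  \<open>y = S x - R x\<close> the nonnegative numbers \<open>inner (S y) y\<close> and
  \<open>inner (R y) y\<close> add up to 0, so \<open>S y = R y = 0\<close>, and by symmetry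
  \<open>y\<close> is orthogonal to itself.\<close>

lemma positive_sqrt_unique:
  fixes S R :: "'a::complex_inner \<Rightarrow> 'a"
  assumes S: "positive_op S" and R: "positive_op R" and eq: "\<And>x. S (S x) = R (R x)"
    and comm: "\<And>x. S (R x) = R (S x)"
  shows "S = R"
proof
  fix x
  have S_op: "bounded_op S" and R_op: "bounded_op R"
    using S R by (simp_all add: positive_op_def)
  define y where "y = S x - R x"
  have "S y + R y = 0"
    by (simp add: y_def bounded_op_diff [OF S_op] bounded_op_diff [OF R_op] eq comm)
  then have "inner (S y) y + inner (R y) y = 0"
    by (simp flip: inner_add_left)
  then have "inner (S y) y = 0" "inner (R y) y = 0"
    using positive_op_inner_nonneg [OF S, of y] positive_op_inner_nonneg [OF R, of y] by linarith+
  then have "S y = 0" "R y = 0"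
    by (simp_all add: positive_op_eq_0 S R)
  then have "inner y y = 0"
    using positive_op_inner_symmetric [OF S, of x y] positive_op_inner_symmetric [OF R, of x y]
    by (simp add: y_def inner_diff_left del: inner_eq_zero_iff)
  then show "S x = R x"
    by (simp add: y_def)
qed

lemma
  fixes T :: "'a::complex_hilbert \<Rightarrow> 'a"
  assumes T: "positive_op T"
  shows positive_op_sqrt_op: "positive_op (sqrt_op T)"
    and sqrt_op_square: "sqrt_op T (sqrt_op T x) = T x"
proof -
  obtain R where R: "positive_op R" "\<And>x. R (R x) = T x"
      "\<And>Q x. bounded_op Q \<Longrightarrow> (\<And>x. Q (T x) = T (Q x)) \<Longrightarrow> Q (R x) = R (Q x)"
    using positive_sqrt_exists [OF T] by blast
  have "sqrt_op T = R"
    unfolding sqrt_op_def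
  proof (rule the_equality)
    show "positive_op R \<and> R \<circ> R = T"
      using R by (auto simp: fun_eq_iff)
    fix S assume S: "positive_op S \<and> S \<circ> S = T"
    then have SS: "S (S x) = T x" for x
      by (auto simp: fun_eq_iff)
    \<comment> \<open>Any root of \<open>T\<close> commutes with its own square, and therefore with
      the constructed root \<open>R\<close>.\<close>
    have "S (T x) = T (S x)" for x
      by (simp add: SS [symmetric])
    then have "S (R x) = R (S x)" for x
      using S by (intro R(3)) (auto simp: positive_op_def)
    then show "S = R"
      using S R SS by (intro positive_sqrt_unique) auto
  qed
  with R show "positive_op (sqrt_op T)" "sqrt_op T (sqrt_op T x) = T x"
    by auto
qed

lemma norm_sqrt_op_square:
  fixes T :: "'a::complex_hilbert \<Rightarrow> 'a"
  assumes "positive_op T"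
  shows "(norm (sqrt_op T x))\<^sup>2 = inner (T x) x"
  by (simp add: power2_norm_eq_inner positive_op_inner_symmetric [OF positive_op_sqrt_op [OF assms]]
      sqrt_op_square [OF assms] inner_commute)

section \<open>Square-summable families and operator matrices\<close>

lemma ell2_nth_sum: "ell2_nth (\<Sum>p\<in>K. f p) j = (\<Sum>p\<in>K. ell2_nth (f p) j)"
  by (induction K rule: infinite_finite_induct) (simp_all add: zero_ell2.rep_eq plus_ell2.rep_eq)

lemmas ell2_nth_simps = zero_ell2.rep_eq plus_ell2.rep_eq minus_ell2.rep_eq scaleC_ell2.rep_eq
  ell2_single.rep_eq ell2_nth_sum

lemma cinner_ell2_single_left: "cinner (ell2_single i \<eta>) x = cinner \<eta> (ell2_nth x i)"
  by (metis cinner_ell2_single_right cinner_commute)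

lemma norm_ell2_single: "norm (ell2_single i \<xi>) = norm \<xi>"
proof -
  have "complex_of_real ((norm (ell2_single i \<xi>))\<^sup>2) = complex_of_real ((norm \<xi>)\<^sup>2)"
    by (simp only: cinner_self [symmetric] cinner_ell2_single_right ell2_single.rep_eq simp_thms if_True)
  then show ?thesis
    by (simp only: of_real_eq_iff power2_eq_iff_nonneg norm_ge_zero)
qed

lemma has_sum_cinner_ell2:
  "((\<lambda>j. cinner (ell2_nth x j) (ell2_nth y j)) has_sum cinner x y) UNIV"
  unfolding cinner_ell2_def by (intro has_sum_infsum cinner_ell2_summable)

lemma has_sum_norm_ell2: "((\<lambda>j. (norm (ell2_nth x j))\<^sup>2) has_sum (norm x)\<^sup>2) UNIV"
  unfolding norm_ell2_square by (intro has_sum_infsum ell2_summable)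

section \<open>Truncation to finitely many coordinates\<close>

definition ell2_restrict :: "'j set \<Rightarrow> ('j, 'h::complex_inner) ell2 \<Rightarrow> ('j, 'h) ell2"
  where "ell2_restrict K x = (\<Sum>j\<in>K. ell2_single j (ell2_nth x j))"

lemma ell2_nth_restrict:
  "finite K \<Longrightarrow> ell2_nth (ell2_restrict K x) j = (if j \<in> K then ell2_nth x j else 0)"
  by (simp add: ell2_restrict_def ell2_nth_simps)

lemma ell2_restrict_diff: "finite K \<Longrightarrow> ell2_restrict K (x - y) = ell2_restrict K x - ell2_restrict K y"
  by (rule ell2_eqI) (simp add: ell2_nth_restrict ell2_nth_simps)

lemma
  assumes "finite K"
  shows inner_ell2_restrict: "inner (ell2_restrict K x) x = (\<Sum>j\<in>K. (norm (ell2_nth x j))\<^sup>2)"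
    and norm_ell2_restrict: "(norm (ell2_restrict K x))\<^sup>2 = (\<Sum>j\<in>K. (norm (ell2_nth x j))\<^sup>2)"
proof -
  have "cinner (ell2_restrict K x) y = (\<Sum>j\<in>K. cinner (ell2_nth x j) (ell2_nth y j))" for y
    by (simp add: ell2_restrict_def cinner_sum_left cinner_ell2_single_left)
  then have "inner (ell2_restrict K x) y = (\<Sum>j\<in>K. inner (ell2_nth x j) (ell2_nth y j))" for y
    by (simp add: inner_eq_Re_cinner)
  then show "inner (ell2_restrict K x) x = (\<Sum>j\<in>K. (norm (ell2_nth x j))\<^sup>2)"
    and "(norm (ell2_restrict K x))\<^sup>2 = (\<Sum>j\<in>K. (norm (ell2_nth x j))\<^sup>2)"
    by (simp_all add: power2_norm_eq_inner ell2_nth_restrict assms)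
qed

lemma norm_ell2_restrict_le: "finite K \<Longrightarrow> norm (ell2_restrict K x) \<le> norm x"
  by (rule power2_le_imp_le) (simp_all add: norm_ell2_restrict ell2_finite_sum_le)

text \<open>Truncation is an orthogonal projection, so the squared error is the tail of the series
  for the squared norm.\<close>

lemma tendsto_ell2_restrict:
  "((\<lambda>K. ell2_restrict K x) \<longlongrightarrow> x) (finite_subsets_at_top UNIV)"
proof -
  let ?F = "finite_subsets_at_top UNIV"
  have "((\<lambda>K. (norm x)\<^sup>2 - (\<Sum>j\<in>K. (norm (ell2_nth x j))\<^sup>2)) \<longlongrightarrow> (norm x)\<^sup>2 - (norm x)\<^sup>2) ?F"
    by (intro tendsto_intros has_sum_norm_ell2 [unfolded has_sum_def])
  moreover have "\<forall>\<^sub>F K in ?F. (norm (ell2_restrict K x - x))\<^sup>2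
      = (norm x)\<^sup>2 - (\<Sum>j\<in>K. (norm (ell2_nth x j))\<^sup>2)"
  proof (rule eventually_finite_subsets_at_top_weakI)
    fix K :: "'a set" assume "finite K"
    then show "(norm (ell2_restrict K x - x))\<^sup>2 = (norm x)\<^sup>2 - (\<Sum>j\<in>K. (norm (ell2_nth x j))\<^sup>2)"
      using inner_ell2_restrict [of K x] norm_ell2_restrict [of K x]
      by (simp add: power2_norm_eq_inner inner_diff_left inner_diff_right inner_commute)
  qed
  ultimately have "((\<lambda>K. (norm (ell2_restrict K x - x))\<^sup>2) \<longlongrightarrow> 0) ?F"
    by (simp add: tendsto_cong)
  from tendsto_real_sqrt [OF this] have "((\<lambda>K. norm (ell2_restrict K x - x)) \<longlongrightarrow> 0) ?F"
    by simp
  then show ?thesis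
    by (rule LIM_zero_cancel [OF tendsto_norm_zero_cancel])
qed

lemma has_sum_ell2_single: "((\<lambda>j. ell2_single j (ell2_nth x j)) has_sum x) UNIV"
  using tendsto_ell2_restrict [of x] by (simp add: has_sum_def ell2_restrict_def [abs_def])

text \<open>Families supported at one index have dense span. This is the uniqueness behind
  \<open>op_of_matrix\<close>.\<close>

lemma bounded_op_ell2_eqI:
  assumes "bounded_op S" "bounded_op T"
    and eq: "\<And>j \<xi>. S (ell2_single j \<xi>) = T (ell2_single j \<xi>)"
  shows "S = T"
proof
  fix x
  note bl = assms(1,2) [THEN bounded_op_bounded_linear]
  have "((\<lambda>j. S (ell2_single j (ell2_nth x j))) has_sum S x) UNIV"
    by (rule has_sum_bounded_linear [OF bl(1) has_sum_ell2_single])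
  moreover have "((\<lambda>j. S (ell2_single j (ell2_nth x j))) has_sum T x) UNIV"
    unfolding eq by (rule has_sum_bounded_linear [OF bl(2) has_sum_ell2_single])
  ultimately show "S x = T x"
    by (rule has_sum_unique)
qed

section \<open>Correspondence between bounded matrices and operators\<close>

lemma op_of_matrix_eqI:
  assumes "represents_op A T"
  shows "op_of_matrix A = T"
  unfolding op_of_matrix_def
proof (rule the_equality [where P = "represents_op A", OF assms])
  fix S assume "represents_op A S"
  with assms have "bounded_op S" "bounded_op T" "matrix_of_op S = matrix_of_op T"
    by (auto simp: represents_op_iff)
  then show "S = T"
    by (intro bounded_op_ell2_eqI ell2_eqI) (auto simp: matrix_of_op_def fun_eq_iff)
qed

lemma
  assumes "bounded_matrix A"
  shows bounded_op_op_of_matrix: "bounded_op (op_of_matrix A)"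
    and matrix_of_op_op_of_matrix: "matrix_of_op (op_of_matrix A) = A"
proof -
  obtain T where "represents_op A T"
    using assms by (auto simp: bounded_matrix_def)
  moreover from this have "op_of_matrix A = T"
    by (rule op_of_matrix_eqI)
  ultimately show "bounded_op (op_of_matrix A)" "matrix_of_op (op_of_matrix A) = A"
    by (auto simp: represents_op_iff)
qed

lemma ell2_nth_op_of_matrix_single:
  "bounded_matrix A \<Longrightarrow> ell2_nth (op_of_matrix A (ell2_single j \<xi>)) i = A i j \<xi>"
  by (metis matrix_of_op_op_of_matrix matrix_of_op_def)

lemma
  assumes T: "bounded_op T"
  shows op_of_matrix_of_op: "op_of_matrix (matrix_of_op T) = T"
    and bounded_matrix_of_op: "bounded_matrix (matrix_of_op T)"
proof -
  have rep: "represents_op (matrix_of_op T) T"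
    by (simp add: represents_op_iff T)
  then show "op_of_matrix (matrix_of_op T) = T"
    by (rule op_of_matrix_eqI)
  have "bounded_op (matrix_of_op T i j)" for i j
  proof (rule bounded_opI)
    have single: "ell2_single j (\<xi> + \<eta>) = ell2_single j \<xi> + ell2_single j \<eta>"
      "ell2_single j (c *\<^sub>C \<xi>) = c *\<^sub>C ell2_single j \<xi>" for \<xi> \<eta> :: 'b and c
      by (auto intro!: ell2_eqI simp: ell2_nth_simps)
    show "matrix_of_op T i j (\<xi> + \<eta>) = matrix_of_op T i j \<xi> + matrix_of_op T i j \<eta>" for \<xi> \<eta>
      by (simp add: matrix_of_op_def single bounded_op_add [OF T] ell2_nth_simps)
    show "matrix_of_op T i j (c *\<^sub>C \<xi>) = c *\<^sub>C matrix_of_op T i j \<xi>" for c \<xi>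
      by (simp add: matrix_of_op_def single bounded_op_scaleC [OF T] ell2_nth_simps)
    show "norm (matrix_of_op T i j \<xi>) \<le> onorm T * norm \<xi>" for \<xi>
      using norm_ell2_nth_le [of "T (ell2_single j \<xi>)" i] bounded_op_norm_le [OF T, of "ell2_single j \<xi>"]
      by (simp add: matrix_of_op_def norm_ell2_single)
  qed
  with rep show "bounded_matrix (matrix_of_op T)"
    by (auto simp: bounded_matrix_def bounded_entries_def)
qed

section \<open>Operators on the triple tensor product\<close>

lift_definition ell2_flip :: "('i \<times> 'k, 'h::complex_inner) ell2 \<Rightarrow> ('k \<times> 'i, 'h) ell2"
  is "\<lambda>f (k, i). f (i, k)"
proof -
  fix f :: "'i \<times> 'k \<Rightarrow> 'h"
  assume "(\<lambda>p. (norm (f p))\<^sup>2) summable_on UNIV"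
  then have "(\<lambda>(k, i). (norm (f (i, k)))\<^sup>2) summable_on UNIV \<times> UNIV"
    using summable_on_swap [of "\<lambda>p. (norm (f p))\<^sup>2" UNIV UNIV] by simp
  then show "(\<lambda>p. (norm (case p of (k, i) \<Rightarrow> f (i, k)))\<^sup>2) summable_on UNIV"
    by (simp add: case_prod_beta')
qed

text \<open>The component of a vector along the \<open>k\<close>-th basis vector of the last tensor
  factor.\<close>

lift_definition ell2_slice :: "'k \<Rightarrow> ('i \<times> 'k, 'h::complex_inner) ell2 \<Rightarrow> ('i, 'h) ell2"
  is "\<lambda>k f i. f (i, k)"
proof -
  fix k :: 'k and f :: "'i \<times> 'k \<Rightarrow> 'h"
  assume "(\<lambda>p. (norm (f p))\<^sup>2) summable_on UNIV"
  then have "(\<lambda>p. (norm (f p))\<^sup>2) summable_on range (\<lambda>i. (i, k))"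
    by (rule summable_on_subset_banach) simp
  then show "(\<lambda>i. (norm (f (i, k)))\<^sup>2) summable_on UNIV"
    by (subst (asm) summable_on_reindex) (auto simp: inj_on_def o_def)
qed

lift_definition ell2_embed :: "('j, 'h::complex_inner) ell2 \<Rightarrow> ('j \<times> 'j, 'h) ell2"
  is "\<lambda>f (i, k). if i = k then f i else 0"
proof -
  fix f :: "'j \<Rightarrow> 'h"
  assume "(\<lambda>j. (norm (f j))\<^sup>2) summable_on UNIV"
  then have "(\<lambda>p. (norm (f (fst p)))\<^sup>2) summable_on range (\<lambda>j. (j, j))"
    by (subst summable_on_reindex) (auto simp: inj_on_def o_def)
  then show "(\<lambda>p. (norm (case p of (i, k) \<Rightarrow> if i = k then f i else 0))\<^sup>2) summable_on UNIV"
    by (rule summable_on_cong_neutral [THEN iffD1, rotated -1]) auto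
qed

lift_definition ell2_diag :: "('j \<times> 'j, 'h::complex_inner) ell2 \<Rightarrow> ('j, 'h) ell2"
  is "\<lambda>f j. f (j, j)"
proof -
  fix f :: "'j \<times> 'j \<Rightarrow> 'h"
  assume "(\<lambda>p. (norm (f p))\<^sup>2) summable_on UNIV"
  then have "(\<lambda>p. (norm (f p))\<^sup>2) summable_on range (\<lambda>i. (i, i))"
    by (rule summable_on_subset_banach) simp
  then show "(\<lambda>i. (norm (f (i, i)))\<^sup>2) summable_on UNIV"
    by (subst (asm) summable_on_reindex) (auto simp: inj_on_def o_def)
qed

lemmas ell2_ops_nth = ell2_flip.rep_eq ell2_slice.rep_eq ell2_embed.rep_eq ell2_diag.rep_eq

lemma cinner_ell2_flip: "cinner (ell2_flip \<Phi>) \<Psi> = cinner \<Phi> (ell2_flip \<Psi>)"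
proof (rule has_sum_unique)
  show "((\<lambda>p. cinner (ell2_nth (ell2_flip \<Phi>) p) (ell2_nth \<Psi> p)) has_sum cinner (ell2_flip \<Phi>) \<Psi>) UNIV"
    by (rule has_sum_cinner_ell2)
  have "((\<lambda>p. cinner (ell2_nth \<Phi> p) (ell2_nth (ell2_flip \<Psi>) p)) has_sum cinner \<Phi> (ell2_flip \<Psi>)) (UNIV \<times> UNIV)"
    using has_sum_cinner_ell2 [of \<Phi> "ell2_flip \<Psi>"] by simp
  then show "((\<lambda>p. cinner (ell2_nth (ell2_flip \<Phi>) p) (ell2_nth \<Psi> p)) has_sum cinner \<Phi> (ell2_flip \<Psi>)) UNIV"
    by (subst (asm) has_sum_swap) (simp add: ell2_ops_nth case_prod_beta')
qed

lemma ell2_flip_flip: "ell2_flip (ell2_flip \<Phi>) = \<Phi>"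
  by (rule ell2_eqI) (simp add: ell2_ops_nth case_prod_beta)

lemma norm_ell2_flip: "norm (ell2_flip \<Phi>) = norm \<Phi>"
  by (simp add: norm_eq_sqrt_inner inner_eq_Re_cinner cinner_ell2_flip ell2_flip_flip)

lemma bounded_op_ell2_flip: "bounded_op ell2_flip"
  by (rule bounded_opI [where K = 1])
    (auto intro!: ell2_eqI simp: ell2_ops_nth ell2_nth_simps norm_ell2_flip case_prod_beta)

lemma cinner_ell2_embed: "cinner (ell2_embed x) \<Psi> = cinner x (ell2_diag \<Psi>)"
proof (rule has_sum_unique)
  have "((\<lambda>p. cinner (ell2_nth (ell2_embed x) p) (ell2_nth \<Psi> p)) has_sum cinner (ell2_embed x) \<Psi>)
      (range (\<lambda>j. (j, j)))"
    by (rule has_sum_cong_neutral [THEN iffD1, OF _ _ _ has_sum_cinner_ell2]) (auto simp: ell2_ops_nth)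
  then show "((\<lambda>j. cinner (ell2_nth x j) (ell2_nth \<Psi> (j, j))) has_sum cinner (ell2_embed x) \<Psi>) UNIV"
    by (subst (asm) has_sum_reindex) (auto simp: inj_on_def o_def ell2_ops_nth)
  show "((\<lambda>j. cinner (ell2_nth x j) (ell2_nth \<Psi> (j, j))) has_sum cinner x (ell2_diag \<Psi>)) UNIV"
    using has_sum_cinner_ell2 [of x "ell2_diag \<Psi>"] by (simp add: ell2_ops_nth)
qed

lemma ell2_diag_embed: "ell2_diag (ell2_embed x) = x"
  by (rule ell2_eqI) (simp add: ell2_ops_nth)

lemma norm_ell2_embed: "norm (ell2_embed x) = norm x"
  by (simp add: norm_eq_sqrt_inner inner_eq_Re_cinner cinner_ell2_embed ell2_diag_embed)

lemma bounded_op_ell2_embed: "bounded_op ell2_embed"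
  by (rule bounded_opI [where K = 1])
    (auto intro!: ell2_eqI simp: ell2_ops_nth ell2_nth_simps norm_ell2_embed)

text \<open>As the adjoint of the isometry \<open>ell2_embed\<close>, it is a contraction.\<close>

lemma bounded_op_ell2_diag: "bounded_op ell2_diag"
proof (rule bounded_opI)
  fix \<Psi> :: "('a \<times> 'a, 'b) ell2"
  show "norm (ell2_diag \<Psi>) \<le> 1 * norm \<Psi>"
  proof (rule norm_le_cinnerI)
    show "cmod (cinner (ell2_diag \<Psi>) z) \<le> 1 * norm \<Psi> * norm z" for z
      using cinner_cauchy_schwarz [of "ell2_embed z" \<Psi>]
      by (simp add: cinner_ell2_embed norm_ell2_embed cinner_commute [of "ell2_diag \<Psi>" z] mult.commute)
  qed simp
qed (auto intro!: ell2_eqI simp: ell2_ops_nth ell2_nth_simps)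

lemma V_op_eq_ell2_embed: "V_op = ell2_embed"
proof
  fix x :: "('a, 'b) ell2"
  have single: "ell2_embed (ell2_single j \<xi>) = ell2_single (j, j) \<xi>" for j :: 'a and \<xi> :: 'b
    by (rule ell2_eqI) (auto simp: ell2_ops_nth ell2_nth_simps split: if_splits)
  show "V_op x = ell2_embed x"
    unfolding V_op_def single [symmetric]
    by (rule infsumI has_sum_bounded_linear bounded_op_bounded_linear bounded_op_ell2_embed
        has_sum_ell2_single)+
qed

lemma adjoint_V_op: "adjoint_op V_op = ell2_diag"
  unfolding V_op_eq_ell2_embed by (rule adjoint_op_eqI) (rule cinner_ell2_embed)

text \<open>Fubini, after swapping the two indices: the triple product is the orthogonal sum of its
  slices.\<close>

lemma has_sum_cinner_ell2_slice:
  "((\<lambda>k. cinner (ell2_slice k \<Phi>) (ell2_slice k \<Psi>)) has_sum cinner \<Phi> \<Psi>) UNIV"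
proof (rule has_sum_Sigma')
  have "((\<lambda>p. cinner (ell2_nth \<Phi> p) (ell2_nth \<Psi> p)) has_sum cinner \<Phi> \<Psi>) (UNIV \<times> UNIV)"
    using has_sum_cinner_ell2 [of \<Phi> \<Psi>] by simp
  then show "((\<lambda>(k, i). cinner (ell2_nth \<Phi> (i, k)) (ell2_nth \<Psi> (i, k))) has_sum cinner \<Phi> \<Psi>)
      (UNIV \<times> UNIV)"
    by (subst (asm) has_sum_swap)
  show "((\<lambda>i. case (k, i) of (k, i) \<Rightarrow> cinner (ell2_nth \<Phi> (i, k)) (ell2_nth \<Psi> (i, k)))
      has_sum cinner (ell2_slice k \<Phi>) (ell2_slice k \<Psi>)) UNIV" for k
    using has_sum_cinner_ell2 [of "ell2_slice k \<Phi>" "ell2_slice k \<Psi>"] by (simp add: ell2_ops_nth)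
qed

lemma has_sum_norm_ell2_slice: "((\<lambda>k. (norm (ell2_slice k \<Phi>))\<^sup>2) has_sum (norm \<Phi>)\<^sup>2) UNIV"
  using has_sum_Re [OF has_sum_cinner_ell2_slice [of \<Phi> \<Phi>]] by (simp add: cinner_self)

text \<open>\<open>ell2_ampl T\<close> is \<open>T \<otimes> I\<close>.\<close>

definition ell2_ampl ::
    "(('i, 'h::complex_inner) ell2 \<Rightarrow> ('i, 'h) ell2) \<Rightarrow> ('i \<times> 'k, 'h) ell2 \<Rightarrow> ('i \<times> 'k, 'h) ell2"
  where "ell2_ampl T \<Psi> = Abs_ell2 (\<lambda>(i, k). ell2_nth (T (ell2_slice k \<Psi>)) i)"

context
  fixes T :: "('i, 'h::complex_inner) ell2 \<Rightarrow> ('i, 'h) ell2"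
  assumes T: "bounded_op T"
begin

text \<open>Unfolding \<open>Abs_ell2\<close> requires the defining family to be square-summable.
  Slice by slice its squared norm is at most \<open>(onorm T)^2\<close> times that of the slice of
  \<open>\<Psi>\<close>, and these are summable.\<close>

lemma ell2_nth_ampl: "ell2_nth (ell2_ampl T \<Psi>) (i, k) = ell2_nth (T (ell2_slice k \<Psi>)) i"
proof -
  have "(\<lambda>(k, i). (norm (ell2_nth (T (ell2_slice k \<Psi>)) i))\<^sup>2) summable_on UNIV \<times> UNIV"
  proof (rule summable_on_SigmaI)
    show "((\<lambda>i. case (k, i) of (k, i) \<Rightarrow> (norm (ell2_nth (T (ell2_slice k \<Psi>)) i))\<^sup>2)
        has_sum (norm (T (ell2_slice k \<Psi>)))\<^sup>2) UNIV" for k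
      using has_sum_norm_ell2 by simp
    show "(\<lambda>k. (norm (T (ell2_slice k \<Psi>)))\<^sup>2) summable_on UNIV"
    proof (rule summable_on_comparison_test)
      show "(\<lambda>k. (onorm T)\<^sup>2 * (norm (ell2_slice k \<Psi>))\<^sup>2) summable_on UNIV"
        by (intro summable_on_cmult_right has_sum_imp_summable [OF has_sum_norm_ell2_slice])
      show "(norm (T (ell2_slice k \<Psi>)))\<^sup>2 \<le> (onorm T)\<^sup>2 * (norm (ell2_slice k \<Psi>))\<^sup>2" for k
        using power_mono [OF bounded_op_norm_le [OF T, of "ell2_slice k \<Psi>"]]
        by (simp add: power_mult_distrib)
    qed simp
  qed auto
  then have "(\<lambda>(i, k). (norm (ell2_nth (T (ell2_slice k \<Psi>)) i))\<^sup>2) summable_on UNIV \<times> UNIV"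
    by (subst (asm) summable_on_swap) simp
  then have "(\<lambda>p. (norm (case p of (i, k) \<Rightarrow> ell2_nth (T (ell2_slice k \<Psi>)) i))\<^sup>2) summable_on UNIV"
    by (simp add: case_prod_beta')
  then show ?thesis
    by (simp add: ell2_ampl_def Abs_ell2_inverse)
qed

lemma ell2_slice_ampl: "ell2_slice k (ell2_ampl T \<Psi>) = T (ell2_slice k \<Psi>)"
  by (rule ell2_eqI) (simp add: ell2_ops_nth ell2_nth_ampl)

lemma bounded_op_ell2_ampl: "bounded_op (ell2_ampl T :: ('i \<times> 'k, 'h) ell2 \<Rightarrow> _)"
proof (rule bounded_opI)
  fix \<Phi> \<Psi> :: "('i \<times> 'k, 'h) ell2" and c
  have slice: "ell2_slice k (\<Phi> + \<Psi>) = ell2_slice k \<Phi> + ell2_slice k \<Psi>"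
    "ell2_slice k (c *\<^sub>C \<Psi>) = c *\<^sub>C ell2_slice k \<Psi>" for k
    by (auto intro!: ell2_eqI simp: ell2_ops_nth ell2_nth_simps)
  show "ell2_ampl T (\<Phi> + \<Psi>) = ell2_ampl T \<Phi> + ell2_ampl T \<Psi>"
    by (rule ell2_eqI) (auto simp: split_paired_all ell2_nth_ampl ell2_nth_simps slice bounded_op_add [OF T])
  show "ell2_ampl T (c *\<^sub>C \<Psi>) = c *\<^sub>C ell2_ampl T \<Psi>"
    by (rule ell2_eqI) (auto simp: split_paired_all ell2_nth_ampl ell2_nth_simps slice bounded_op_scaleC [OF T])
  have "(norm (ell2_ampl T \<Psi>))\<^sup>2 \<le> (onorm T)\<^sup>2 * (norm \<Psi>)\<^sup>2"
  proof (rule has_sum_mono)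
    show "((\<lambda>k. (norm (T (ell2_slice k \<Psi>)))\<^sup>2) has_sum (norm (ell2_ampl T \<Psi>))\<^sup>2) UNIV"
      using has_sum_norm_ell2_slice [of "ell2_ampl T \<Psi>"] by (simp add: ell2_slice_ampl)
    show "((\<lambda>k. (onorm T)\<^sup>2 * (norm (ell2_slice k \<Psi>))\<^sup>2) has_sum (onorm T)\<^sup>2 * (norm \<Psi>)\<^sup>2) UNIV"
      by (intro has_sum_cmult_right has_sum_norm_ell2_slice)
    show "(norm (T (ell2_slice k \<Psi>)))\<^sup>2 \<le> (onorm T)\<^sup>2 * (norm (ell2_slice k \<Psi>))\<^sup>2" for k
      using power_mono [OF bounded_op_norm_le [OF T, of "ell2_slice k \<Psi>"]]
      by (simp add: power_mult_distrib)
  qed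
  then have "(norm (ell2_ampl T \<Psi>))\<^sup>2 \<le> (onorm T * norm \<Psi>)\<^sup>2"
    by (simp add: power_mult_distrib)
  then show "norm (ell2_ampl T \<Psi>) \<le> onorm T * norm \<Psi>"
    by (rule power2_le_imp_le) (simp add: bounded_op_onorm_nonneg [OF T])
qed

end

lemma cinner_ell2_ampl:
  fixes T :: "('i, 'h::complex_hilbert) ell2 \<Rightarrow> ('i, 'h) ell2"
  assumes T: "bounded_op T"
  shows "cinner (ell2_ampl T \<Phi>) \<Psi> = cinner \<Phi> (ell2_ampl (adjoint_op T) \<Psi>)"
proof (rule has_sum_unique)
  show "((\<lambda>k. cinner (T (ell2_slice k \<Phi>)) (ell2_slice k \<Psi>)) has_sum cinner (ell2_ampl T \<Phi>) \<Psi>) UNIV"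
    using has_sum_cinner_ell2_slice [of "ell2_ampl T \<Phi>" \<Psi>] by (simp add: ell2_slice_ampl T)
  show "((\<lambda>k. cinner (T (ell2_slice k \<Phi>)) (ell2_slice k \<Psi>))
      has_sum cinner \<Phi> (ell2_ampl (adjoint_op T) \<Psi>)) UNIV"
    using has_sum_cinner_ell2_slice [of \<Phi> "ell2_ampl (adjoint_op T) \<Psi>"]
    by (simp add: ell2_slice_ampl bounded_op_adjoint_op T cinner_adjoint_op)
qed

section \<open>Identification of the strong limits\<close>

lemma strong_limit_eqI:
  assumes "((\<lambda>G. T G x) \<longlongrightarrow> l) (finite_subsets_at_top UNIV)"
  shows "strong_limit T x = l"
  unfolding strong_limit_def by (rule tendsto_Lim [OF finite_subsets_at_top_neq_bot assms])

text \<open>The strong limits run over finite \<open>G\<close>, truncation over finite sets of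
  pairs; the squares \<open>G \<times> G\<close> are cofinal among the latter.\<close>

lemma tendsto_ell2_restrict_square:
  fixes \<Psi> :: "('j \<times> 'j, 'h::complex_inner) ell2"
  shows "((\<lambda>G. ell2_restrict (G \<times> G) \<Psi>) \<longlongrightarrow> \<Psi>) (finite_subsets_at_top UNIV)"
proof (rule filterlim_compose [OF tendsto_ell2_restrict])
  show "filterlim (\<lambda>G :: 'j set. G \<times> G) (finite_subsets_at_top UNIV)
    (finite_subsets_at_top UNIV)"
    unfolding filterlim_finite_subsets_at_top
  proof (intro allI impI)
    fix X assume X: "finite X \<and> X \<subseteq> (UNIV :: ('j \<times> 'j) set)"
    show "\<forall>\<^sub>F G in finite_subsets_at_top UNIV. finite (G \<times> G) \<and> X \<subseteq> G \<times> G \<and> G \<times> G \<subseteq> UNIV"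
      unfolding eventually_finite_subsets_at_top
      using X by (intro exI [of _ "fst ` X \<union> snd ` X"]) force
  qed
qed

lemma flip_op_eq_ell2_flip: "flip_op = ell2_flip"
proof
  fix \<Psi> :: "('a \<times> 'a, 'b) ell2"
  show "flip_op \<Psi> = ell2_flip \<Psi>"
    unfolding flip_op_def
  proof (rule strong_limit_eqI)
    have "(\<Sum>i\<in>G. \<Sum>j\<in>G. tensor_unit i j id j i \<Psi>) = ell2_restrict (G \<times> G) (ell2_flip \<Psi>)" for G
      by (simp add: ell2_restrict_def sum.cartesian_product tensor_unit_def ell2_ops_nth case_prod_beta)
    then show "((\<lambda>G. \<Sum>i\<in>G. \<Sum>j\<in>G. tensor_unit i j id j i \<Psi>) \<longlongrightarrow> ell2_flip \<Psi>)
        (finite_subsets_at_top UNIV)"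
      by (simp add: tendsto_ell2_restrict_square)
  qed
qed

text \<open>Write \<open>L\<close> for the amplification and \<open>P\<close> for truncation to
  \<open>G \<times> G\<close>. The partial sums are \<open>P L P\<close>, and
  \<open>P L P \<Psi> = P (L P \<Psi> - L \<Psi>) + P L \<Psi>\<close>; the first term vanishes in
  the limit because each \<open>P\<close> is a contraction.\<close>

lemma lambda_rep_eq_ell2_ampl:
  assumes A: "bounded_matrix A"
  shows "lambda_rep A = ell2_ampl (op_of_matrix A)"
proof
  fix \<Psi>
  let ?F = "finite_subsets_at_top UNIV"
  let ?T = "op_of_matrix A"
  let ?L = "ell2_ampl ?T"
  have T: "bounded_op ?T"
    by (rule bounded_op_op_of_matrix [OF A])
  interpret T: bounded_linear ?T
    by (rule bounded_op_bounded_linear [OF T])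
  have L: "bounded_linear ?L"
    by (intro bounded_op_bounded_linear bounded_op_ell2_ampl T)
  have partial: "(\<Sum>i\<in>G. \<Sum>j\<in>G. \<Sum>k\<in>G. tensor_unit i j (A i j) k k \<Psi>)
      = ell2_restrict (G \<times> G) (?L (ell2_restrict (G \<times> G) \<Psi>))" if G: "finite G" for G
  proof (rule ell2_eqI)
    fix p :: "'a \<times> 'a"
    obtain i k where p: "p = (i, k)"
      by force
    have "ell2_slice k (ell2_restrict (G \<times> G) \<Psi>) = (\<Sum>j\<in>G. ell2_single j (ell2_nth \<Psi> (j, k)))"
      if "k \<in> G"
      using that by (intro ell2_eqI) (simp add: ell2_ops_nth ell2_nth_restrict ell2_nth_simps G)
    then have "ell2_nth (ell2_restrict (G \<times> G) (?L (ell2_restrict (G \<times> G) \<Psi>))) p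
        = (if i \<in> G \<and> k \<in> G then \<Sum>j\<in>G. A i j (ell2_nth \<Psi> (j, k)) else 0)"
      by (simp add: p ell2_nth_restrict G ell2_nth_ampl [OF T] T.sum ell2_nth_sum
          ell2_nth_op_of_matrix_single [OF A])
    moreover have "ell2_nth (\<Sum>i\<in>G. \<Sum>j\<in>G. \<Sum>k\<in>G. tensor_unit i j (A i j) k k \<Psi>) p
        = (\<Sum>i'\<in>G. \<Sum>j\<in>G. \<Sum>k'\<in>G. if i = i' \<and> k = k' then A i' j (ell2_nth \<Psi> (j, k')) else 0)"
      by (simp add: p ell2_nth_simps tensor_unit_def)
    \<comment> \<open>Nesting the two conditions lets the sums over \<open>i'\<close> and
      \<open>k'\<close> collapse separately.\<close>
    moreover have "\<dots> = (\<Sum>i'\<in>G. if i = i' then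
        \<Sum>j\<in>G. \<Sum>k'\<in>G. if k = k' then A i' j (ell2_nth \<Psi> (j, k')) else 0 else 0)"
      by (rule sum.cong) auto
    ultimately show "ell2_nth (\<Sum>i\<in>G. \<Sum>j\<in>G. \<Sum>k\<in>G. tensor_unit i j (A i j) k k \<Psi>) p
        = ell2_nth (ell2_restrict (G \<times> G) (?L (ell2_restrict (G \<times> G) \<Psi>))) p"
      by (simp add: G)
  qed
  have L_lim: "((\<lambda>G. ?L (ell2_restrict (G \<times> G) \<Psi>)) \<longlongrightarrow> ?L \<Psi>) ?F"
    by (rule bounded_linear.tendsto [OF L tendsto_ell2_restrict_square])
  have "((\<lambda>G. ell2_restrict (G \<times> G) (?L (ell2_restrict (G \<times> G) \<Psi>) - ?L \<Psi>)) \<longlongrightarrow> 0) ?F"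
  proof (rule Lim_null_comparison)
    show "\<forall>\<^sub>F G in ?F. norm (ell2_restrict (G \<times> G) (?L (ell2_restrict (G \<times> G) \<Psi>) - ?L \<Psi>))
        \<le> norm (?L (ell2_restrict (G \<times> G) \<Psi>) - ?L \<Psi>)"
      by (rule eventually_finite_subsets_at_top_weakI) (simp add: norm_ell2_restrict_le)
    show "((\<lambda>G. norm (?L (ell2_restrict (G \<times> G) \<Psi>) - ?L \<Psi>)) \<longlongrightarrow> 0) ?F"
      using L_lim by (simp add: LIM_zero tendsto_norm_zero)
  qed
  from tendsto_add [OF this tendsto_ell2_restrict_square [of "?L \<Psi>"]]
  have lim: "((\<lambda>G. ell2_restrict (G \<times> G) (?L (ell2_restrict (G \<times> G) \<Psi>) - ?L \<Psi>)
      + ell2_restrict (G \<times> G) (?L \<Psi>)) \<longlongrightarrow> ?L \<Psi>) ?F"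
    by simp
  show "lambda_rep A \<Psi> = ?L \<Psi>"
    unfolding lambda_rep_def
  proof (rule strong_limit_eqI, rule Lim_transform_eventually [OF lim])
    show "\<forall>\<^sub>F G in ?F. ell2_restrict (G \<times> G) (?L (ell2_restrict (G \<times> G) \<Psi>) - ?L \<Psi>)
        + ell2_restrict (G \<times> G) (?L \<Psi>) = (\<Sum>i\<in>G. \<Sum>j\<in>G. \<Sum>k\<in>G. tensor_unit i j (A i j) k k \<Psi>)"
      by (rule eventually_finite_subsets_at_top_weakI) (simp add: partial ell2_restrict_diff)
  qed
qed

section \<open>Row and column norms\<close>

lemma bounded_op_sum:
  "(\<And>i. i \<in> G \<Longrightarrow> bounded_op (T i)) \<Longrightarrow> bounded_op (\<lambda>x. \<Sum>i\<in>G. T i x)"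
  by (induction G rule: infinite_finite_induct)
    (auto intro!: bounded_op_plus intro: bounded_opI [where K = 0])

text \<open>For the column operator \<open>b\<close> with components \<open>b i\<close>, this is the
  identity that the norm of \<open>b^* b\<close> is the square of the norm of \<open>b\<close>. Both
  directions are Cauchy-Schwarz, the second one in the finite sum over \<open>G\<close>.\<close>

lemma onorm_gram_le_iff:
  fixes b :: "'i \<Rightarrow> 'a::complex_hilbert \<Rightarrow> 'b::complex_inner"
  assumes b: "\<And>i. bounded_op (b i)" and "0 \<le> c"
  shows "onorm (\<lambda>x. \<Sum>i\<in>G. adjoint_op (b i) (b i x)) \<le> c\<^sup>2
    \<longleftrightarrow> (\<forall>x. (\<Sum>i\<in>G. (norm (b i x))\<^sup>2) \<le> c\<^sup>2 * (norm x)\<^sup>2)"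
    (is "onorm ?Q \<le> _ \<longleftrightarrow> ?R")
proof
  have Q: "bounded_op ?Q"
    using b bounded_op_compose [OF bounded_op_adjoint_op [OF b] b]
    by (intro bounded_op_sum) (simp add: o_def)
  have cinner_Q: "cinner (?Q x) y = (\<Sum>i\<in>G. cinner (b i x) (b i y))" for x y
    by (simp add: cinner_sum_left cinner_adjoint_op' b)
  {
    assume le: "onorm ?Q \<le> c\<^sup>2"
    show ?R
    proof
      fix x
      have "(\<Sum>i\<in>G. (norm (b i x))\<^sup>2) = inner (?Q x) x"
        by (simp add: inner_eq_Re_cinner cinner_Q cinner_self del: of_real_power)
      also have "\<dots> \<le> norm (?Q x) * norm x"
        by (rule norm_cauchy_schwarz)
      also have "\<dots> \<le> (c\<^sup>2 * norm x) * norm x"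
        using bounded_op_norm_le [OF Q, of x] mult_right_mono [OF le norm_ge_zero [of x]]
        by (intro mult_right_mono) auto
      finally show "(\<Sum>i\<in>G. (norm (b i x))\<^sup>2) \<le> c\<^sup>2 * (norm x)\<^sup>2"
        by (simp add: power2_eq_square)
    qed
  }
  assume R: ?R
  have L2: "L2_set (\<lambda>i. norm (b i x)) G \<le> c * norm x" for x
    unfolding L2_set_def using R \<open>0 \<le> c\<close> by (intro real_le_lsqrt) (auto simp: power_mult_distrib)
  show "onorm ?Q \<le> c\<^sup>2"
  proof (rule onorm_bound)
    fix x
    show "norm (?Q x) \<le> c\<^sup>2 * norm x"
    proof (rule norm_le_cinnerI)
      fix z
      have "cmod (cinner (?Q x) z) \<le> (\<Sum>i\<in>G. cmod (cinner (b i x) (b i z)))"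
        unfolding cinner_Q by (rule norm_sum)
      also have "\<dots> \<le> (\<Sum>i\<in>G. \<bar>norm (b i x)\<bar> * \<bar>norm (b i z)\<bar>)"
        by (intro sum_mono) (simp add: cinner_cauchy_schwarz)
      also have "\<dots> \<le> L2_set (\<lambda>i. norm (b i x)) G * L2_set (\<lambda>i. norm (b i z)) G"
        by (rule L2_set_mult_ineq)
      also have "\<dots> \<le> (c * norm x) * (c * norm z)"
        using \<open>0 \<le> c\<close> by (intro mult_mono L2) auto
      finally show "cmod (cinner (?Q x) z) \<le> c\<^sup>2 * norm x * norm z"
        by (simp add: power2_eq_square mult_ac)
    qed simp
  qed simp
qed

text \<open>Trades suprema, operator norms and square roots for finite sums of squared norms, the
  form in which column norms are estimated below.\<close>

lemma col_norm_le_iff: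
  fixes Y :: "('j, 'h::complex_hilbert) op_matrix"
  assumes "bounded_entries Y" "0 \<le> c"
  shows "col_norm Y \<le> ennreal c
    \<longleftrightarrow> (\<forall>j G \<xi>. finite G \<longrightarrow> (\<Sum>i\<in>G. (norm (Y i j \<xi>))\<^sup>2) \<le> c\<^sup>2 * (norm \<xi>)\<^sup>2)"
proof -
  have "sqrt r \<le> c \<longleftrightarrow> r \<le> c\<^sup>2" for r
    using real_sqrt_le_iff [of r "c\<^sup>2"] \<open>0 \<le> c\<close> by simp
  then show ?thesis
    using assms onorm_gram_le_iff [of "\<lambda>i. Y i j" c for j]
    by (auto simp: col_norm_def SUP_le_iff bounded_entries_def)
qed

text \<open>Phrased with entrywise adjoints so that it also covers the possibly unbounded
  \<open>X\<close> of (iii).\<close>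

lemma row_norm_eq_col_norm:
  fixes A :: "('j, 'h::complex_hilbert) op_matrix"
  assumes "bounded_entries A"
  shows "row_norm A = col_norm (\<lambda>i j. adjoint_op (A j i))"
  using assms by (simp add: row_norm_def col_norm_def bounded_entries_def adjoint_op_adjoint_op)

context
  fixes A :: "('j, 'h::complex_hilbert) op_matrix"
  assumes A: "bounded_matrix A"
begin

lemma op_of_matrix_adj: "op_of_matrix (matrix_adj A) = adjoint_op (op_of_matrix A)"
  and bounded_matrix_adj: "bounded_matrix (matrix_adj A)"
  by (simp_all add: matrix_adj_def op_of_matrix_of_op bounded_matrix_of_op bounded_op_adjoint_op
      bounded_op_op_of_matrix A)

lemma matrix_adj_entry: "matrix_adj A i j = adjoint_op (A j i)"
proof (intro ext cinner_eqI)
  fix \<xi> z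
  have "bounded_op (A j i)"
    using A by (simp add: bounded_matrix_def bounded_entries_def)
  then show "cinner (matrix_adj A i j \<xi>) z = cinner (adjoint_op (A j i) \<xi>) z"
    using A by (simp add: matrix_adj_def matrix_of_op_def cinner_ell2_single_right [symmetric]
      cinner_adjoint_op' bounded_op_op_of_matrix cinner_ell2_single_left ell2_nth_op_of_matrix_single)
qed

lemma row_norm_eq_col_norm_adj: "row_norm A = col_norm (matrix_adj A)"
proof -
  have "matrix_adj A = (\<lambda>i j. adjoint_op (A j i))"
    by (intro ext) (simp only: matrix_adj_entry)
  then show ?thesis
    using A by (simp add: row_norm_eq_col_norm bounded_matrix_def)
qed

text \<open>The entries of column \<open>j\<close> applied to \<open>\<xi>\<close> are the
  coordinates of the image of \<open>ell2_single j \<xi>\<close>. In particular, row and column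
  norms of bounded matrices are finite, which lets (ii) be proved with real constants.\<close>

lemma col_norm_le_onorm: "col_norm A \<le> ennreal (onorm (op_of_matrix A))"
proof -
  have T: "bounded_op (op_of_matrix A)"
    by (rule bounded_op_op_of_matrix [OF A])
  have "(\<Sum>i\<in>G. (norm (A i j \<xi>))\<^sup>2) \<le> (onorm (op_of_matrix A))\<^sup>2 * (norm \<xi>)\<^sup>2" if "finite G" for j G \<xi>
  proof -
    have "(\<Sum>i\<in>G. (norm (A i j \<xi>))\<^sup>2) \<le> (norm (op_of_matrix A (ell2_single j \<xi>)))\<^sup>2"
      using ell2_finite_sum_le [OF that, of "op_of_matrix A (ell2_single j \<xi>)"]
      by (simp add: ell2_nth_op_of_matrix_single A)
    also have "\<dots> \<le> (onorm (op_of_matrix A) * norm \<xi>)\<^sup>2"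
      using bounded_op_norm_le [OF T, of "ell2_single j \<xi>"] by (intro power_mono) (simp_all add: norm_ell2_single)
    finally show ?thesis
      by (simp add: power_mult_distrib)
  qed
  then show ?thesis
    using A by (simp add: col_norm_le_iff bounded_matrix_def bounded_op_onorm_nonneg [OF T])
qed

lemma norm_ampl_embed_le:
  assumes "col_norm A \<le> ennreal c" "0 \<le> c"
  shows "norm (ell2_ampl (op_of_matrix A) (ell2_embed \<Xi>)) \<le> c * norm \<Xi>"
proof (rule power2_le_imp_le)
  let ?T = "op_of_matrix A"
  have T: "bounded_op ?T"
    by (rule bounded_op_op_of_matrix [OF A])
  \<comment> \<open>The embedding puts one coordinate into each slice, so slice \<open>k\<close> of
    the amplified vector involves only column \<open>k\<close>.\<close>
  have slice: "ell2_slice k (ell2_embed \<Xi>) = ell2_single k (ell2_nth \<Xi> k)" for k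
    by (rule ell2_eqI) (simp add: ell2_ops_nth ell2_nth_simps)
  have "(norm (ell2_ampl ?T (ell2_embed \<Xi>)))\<^sup>2 \<le> c\<^sup>2 * (norm \<Xi>)\<^sup>2"
  proof (rule has_sum_mono)
    show "((\<lambda>k. (norm (?T (ell2_single k (ell2_nth \<Xi> k))))\<^sup>2)
        has_sum (norm (ell2_ampl ?T (ell2_embed \<Xi>)))\<^sup>2) UNIV"
      using has_sum_norm_ell2_slice [of "ell2_ampl ?T (ell2_embed \<Xi>)"]
      by (simp add: ell2_slice_ampl [OF T] slice)
    show "((\<lambda>k. c\<^sup>2 * (norm (ell2_nth \<Xi> k))\<^sup>2) has_sum c\<^sup>2 * (norm \<Xi>)\<^sup>2) UNIV"
      by (intro has_sum_cmult_right has_sum_norm_ell2)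
    show "(norm (?T (ell2_single k (ell2_nth \<Xi> k))))\<^sup>2 \<le> c\<^sup>2 * (norm (ell2_nth \<Xi> k))\<^sup>2" for k
      unfolding norm_ell2_square [of "?T _"]
      using assms A ell2_summable [of "?T (ell2_single k (ell2_nth \<Xi> k))"]
      by (intro infsum_le_finite_sums)
        (auto simp: ell2_nth_op_of_matrix_single col_norm_le_iff bounded_matrix_def)
  qed
  then show "(norm (ell2_ampl ?T (ell2_embed \<Xi>)))\<^sup>2 \<le> (c * norm \<Xi>)\<^sup>2"
    by (simp add: power_mult_distrib)
qed (use \<open>0 \<le> c\<close> in simp)

end

section \<open>The Schur block product\<close>

lemma cinner_ell2_diag: "cinner (ell2_diag \<Phi>) x = cinner \<Phi> (ell2_embed x)"
  by (metis cinner_ell2_embed cinner_commute)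

text \<open>Follow \<open>\<alpha>_j \<otimes> \<xi>\<close>: embedding and amplified
  \<open>B\<close> give the sum over \<open>i\<close> of
  \<open>\<alpha>_i \<otimes> b_ij \<xi> \<otimes> \<alpha>_j\<close>. The flip exchanges
  \<open>i\<close> and \<open>j\<close>, so slice \<open>i\<close> carries
  \<open>\<alpha>_j \<otimes> b_ij \<xi>\<close>; applying \<open>A\<close> there and reading
  coordinate \<open>i\<close> yields \<open>a_ij b_ij \<xi>\<close>. Without the flip the same
  compression would give the diagonal of the ordinary product.\<close>

lemma represents_op_schur_prod:
  fixes A B :: "('j, 'h::complex_hilbert) op_matrix"
  assumes A: "bounded_matrix A" and B: "bounded_matrix B"
  shows "represents_op (A \<box> B)
    (ell2_diag \<circ> ell2_ampl (op_of_matrix A) \<circ> ell2_flip \<circ> ell2_ampl (op_of_matrix B) \<circ> ell2_embed)"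
    (is "represents_op _ ?S")
proof -
  have TA: "bounded_op (op_of_matrix A)" and TB: "bounded_op (op_of_matrix B)"
    by (simp_all add: bounded_op_op_of_matrix A B)
  have B0: "B i j 0 = 0" for i j
    using B by (simp add: bounded_matrix_def bounded_entries_def bounded_op_zero)
  have slice: "ell2_slice m (ell2_embed (ell2_single j \<xi>)) = (if m = j then ell2_single j \<xi> else 0)"
    for m j and \<xi> :: 'h
    by (rule ell2_eqI) (simp add: ell2_ops_nth ell2_nth_simps)
  have "ell2_slice i (ell2_flip (ell2_ampl (op_of_matrix B) (ell2_embed (ell2_single j \<xi>))))
      = ell2_single j (B i j \<xi>)" for i j \<xi>
    by (rule ell2_eqI) (simp add: ell2_ops_nth ell2_nth_simps ell2_nth_ampl [OF TB] slice
        ell2_nth_op_of_matrix_single [OF B] bounded_op_zero [OF TB])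
  then have "matrix_of_op ?S = A \<box> B"
    by (auto simp: fun_eq_iff matrix_of_op_def schur_prod_def ell2_diag.rep_eq ell2_nth_ampl [OF TA]
        ell2_nth_op_of_matrix_single [OF A])
  moreover have "bounded_op ?S"
    by (intro bounded_op_compose bounded_op_ell2_diag bounded_op_ell2_ampl bounded_op_ell2_flip
        bounded_op_ell2_embed TA TB)
  ultimately show ?thesis
    by (simp add: represents_op_iff)
qed

context
  fixes A B :: "('j, 'h::complex_hilbert) op_matrix"
  assumes A: "bounded_matrix A" and B: "bounded_matrix B"
begin

lemma bounded_matrix_schur_prod: "bounded_matrix (A \<box> B)"
proof -
  have "bounded_entries (A \<box> B)"
    using A B by (simp add: bounded_matrix_def bounded_entries_def schur_prod_def bounded_op_compose)
  then show ?thesis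
    using represents_op_schur_prod [OF A B] by (auto simp: bounded_matrix_def)
qed

lemma op_of_matrix_schur_prod:
  "op_of_matrix (A \<box> B) = adjoint_op V_op \<circ> lambda_rep A \<circ> flip_op \<circ> lambda_rep B \<circ> V_op"
  unfolding adjoint_V_op lambda_rep_eq_ell2_ampl [OF A] lambda_rep_eq_ell2_ampl [OF B]
    flip_op_eq_ell2_flip unfolding V_op_eq_ell2_embed
  by (rule op_of_matrix_eqI [OF represents_op_schur_prod [OF A B]])

lemma cinner_schur_prod:
  "cinner (op_of_matrix (A \<box> B) x) y
    = cinner (ell2_flip (ell2_ampl (op_of_matrix B) (ell2_embed x)))
        (ell2_ampl (adjoint_op (op_of_matrix A)) (ell2_embed y))"
  unfolding op_of_matrix_eqI [OF represents_op_schur_prod [OF A B]]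
  by (simp add: cinner_ell2_diag cinner_ell2_ampl bounded_op_op_of_matrix A)

lemma cmod_cinner_schur_prod_le:
  "cmod (cinner (op_of_matrix (A \<box> B) x) y)
    \<le> norm (ell2_ampl (op_of_matrix B) (ell2_embed x))
      * norm (ell2_ampl (adjoint_op (op_of_matrix A)) (ell2_embed y))"
  using cinner_cauchy_schwarz unfolding cinner_schur_prod by (metis norm_ell2_flip)

lemma onorm_schur_prod_le:
  "ennreal (onorm (op_of_matrix (A \<box> B))) \<le> row_norm A * col_norm B"
proof -
  have adj: "bounded_matrix (matrix_adj A)"
    by (rule bounded_matrix_adj [OF A])
  obtain r where r: "0 \<le> r" "row_norm A = ennreal r"
    using col_norm_le_onorm [OF adj] unfolding row_norm_eq_col_norm_adj [OF A]
    by (cases "col_norm (matrix_adj A)") (auto simp: top_unique)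
  obtain c where c: "0 \<le> c" "col_norm B = ennreal c"
    using col_norm_le_onorm [OF B] by (cases "col_norm B") (auto simp: top_unique)
  have "norm (op_of_matrix (A \<box> B) x) \<le> r * c * norm x" for x
  proof (rule norm_le_cinnerI)
    fix y
    have "cmod (cinner (op_of_matrix (A \<box> B) x) y)
        \<le> norm (ell2_ampl (op_of_matrix B) (ell2_embed x))
          * norm (ell2_ampl (op_of_matrix (matrix_adj A)) (ell2_embed y))"
      using cmod_cinner_schur_prod_le by (simp add: op_of_matrix_adj [OF A])
    also have "\<dots> \<le> (c * norm x) * (r * norm y)"
      using c r row_norm_eq_col_norm_adj [OF A]
      by (intro mult_mono norm_ampl_embed_le B adj) auto
    finally show "cmod (cinner (op_of_matrix (A \<box> B) x) y) \<le> r * c * norm x * norm y"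
      by (simp add: mult_ac)
  qed (use r c in simp)
  then have "onorm (op_of_matrix (A \<box> B)) \<le> r * c"
    using r c by (intro onorm_bound) auto
  then show ?thesis
    using r c by (simp add: ennreal_leI flip: ennreal_mult)
qed

end

text \<open>The test matrix lives in row \<open>i\<close>, where its \<open>j\<close>-th entry maps \<open>\<eta>\<close> to a multiple of
  \<open>x\<^sub>i\<^sub>j\<^sup>* \<eta>\<close>.  Since \<open>sgn 0 = 0\<close>, no case distinction on vanishing vectors is needed.\<close>

lemma row_norm_le_of_schur_multiplier:
  fixes X :: "('j, 'h::complex_hilbert) op_matrix"
  assumes X: "bounded_entries X" and "0 \<le> C"
    and mult: "\<And>Y :: ('j, 'h) op_matrix. bounded_entries Y \<Longrightarrow> col_norm Y < \<infinity> \<Longrightarrow>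
      bounded_matrix (X \<box> Y) \<and> ennreal (onorm (op_of_matrix (X \<box> Y))) \<le> ennreal C * col_norm Y"
  shows "row_norm X \<le> ennreal C"
proof -
  have Xij: "bounded_op (X i j)" for i j
    using X by (simp add: bounded_entries_def)
  have bound: "(\<Sum>j\<in>G. (norm (adjoint_op (X i j) \<eta>))\<^sup>2) \<le> C\<^sup>2 * (norm \<eta>)\<^sup>2" if G: "finite G" for i G \<eta>
  proof -
    define u where "u j = adjoint_op (X i j) \<eta>" for j
    \<comment> \<open>A unit vector along \<open>\<eta>\<close>, or 0 if
      \<open>\<eta> = 0\<close>.\<close>
    define e where "e = sgn \<eta>"
    define Y where "Y i' j \<xi> = (if i' = i then cinner \<xi> e *\<^sub>C sgn (u j) else 0)" for i' j \<xi>
    have norm_e: "norm e \<le> 1" and norm_sgn_le: "norm (sgn (u j)) \<le> 1" for j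
      by (simp_all add: e_def norm_sgn)
    have norm_Y: "norm (Y i' j \<xi>) \<le> norm \<xi>" for i' j \<xi>
    proof -
      have "cmod (cinner \<xi> e) * norm (sgn (u j)) \<le> (norm \<xi> * norm e) * 1"
        by (intro mult_mono cinner_cauchy_schwarz norm_sgn_le) auto
      also have "\<dots> \<le> norm \<xi> * 1"
        using mult_left_mono [OF norm_e norm_ge_zero [of \<xi>]] by simp
      finally show ?thesis
        by (simp add: Y_def norm_scaleC)
    qed
    have Y: "bounded_entries Y"
      unfolding bounded_entries_def
    proof (intro allI bounded_opI [where K = 1])
      show "Y i' j (\<xi> + \<zeta>) = Y i' j \<xi> + Y i' j \<zeta>" for i' j \<xi> \<zeta>
        by (simp add: Y_def cinner_add_left scaleC_add_left)
      show "Y i' j (c *\<^sub>C \<xi>) = c *\<^sub>C Y i' j \<xi>" for i' j c \<xi>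
        by (simp add: Y_def cinner_scaleC_left scaleC_scaleC)
    qed (use norm_Y in simp)
    \<comment> \<open>Only the entry in row \<open>i\<close> of each column can be nonzero, and it
      is a contraction.\<close>
    have "(\<Sum>i'\<in>F. (norm (Y i' j \<xi>))\<^sup>2) \<le> (norm \<xi>)\<^sup>2" if "finite F" for F j \<xi>
    proof -
      have "(\<Sum>i'\<in>F. (norm (Y i' j \<xi>))\<^sup>2) \<le> (\<Sum>i'\<in>F. if i' = i then (norm \<xi>)\<^sup>2 else 0)"
      proof (rule sum_mono)
        fix i'
        show "(norm (Y i' j \<xi>))\<^sup>2 \<le> (if i' = i then (norm \<xi>)\<^sup>2 else 0)"
          using power_mono [OF norm_Y [of i' j \<xi>], of 2] by (auto simp: Y_def)
      qed
      also have "\<dots> \<le> (norm \<xi>)\<^sup>2"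
        using that by simp
      finally show ?thesis .
    qed
    then have col: "col_norm Y \<le> 1"
      using col_norm_le_iff [OF Y, of 1] by simp
    then have "col_norm Y < \<infinity>"
      by (rule le_less_trans) simp
    from mult [OF Y this] have XY: "bounded_matrix (X \<box> Y)"
      and "ennreal (onorm (op_of_matrix (X \<box> Y))) \<le> ennreal C * col_norm Y"
      by auto
    note this(2)
    also have "ennreal C * col_norm Y \<le> ennreal C"
      using mult_left_mono [OF col, of "ennreal C"] by simp
    finally have onorm_Z: "onorm (op_of_matrix (X \<box> Y)) \<le> C"
      using \<open>0 \<le> C\<close> by simp
    define Z where "Z = op_of_matrix (X \<box> Y)"
    have Z_op: "bounded_op Z"
      unfolding Z_def by (rule bounded_op_op_of_matrix [OF XY])
    have Z_single: "ell2_nth (Z (ell2_single j \<xi>)) i' = X i' j (Y i' j \<xi>)" for i' j \<xi>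
      by (simp add: Z_def ell2_nth_op_of_matrix_single [OF XY]) (simp add: schur_prod_def)
    interpret Z: bounded_linear Z
      by (rule bounded_op_bounded_linear [OF Z_op])
    define t where "t = (\<Sum>j\<in>G. (norm (u j))\<^sup>2)"
    \<comment> \<open>The weights undo the normalisation in \<open>Y\<close>: entry \<open>j\<close>
      returns exactly \<open>u j\<close>. Hence the pairing of \<open>Z \<Xi>\<close> with
      \<open>\<eta>\<close> at \<open>i\<close> is \<open>t\<close>, whereas
      \<open>norm \<Xi>\<close> is only of size \<open>sqrt t\<close>; the multiplier bound thus
      reads \<open>t \<le> C * sqrt t * norm \<eta>\<close>.\<close>
    define \<Xi> where "\<Xi> = (\<Sum>j\<in>G. ell2_single j (norm (u j) *\<^sub>R e))"
    have "ell2_restrict G \<Xi> = \<Xi>"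
      by (rule ell2_eqI) (simp add: ell2_nth_restrict G \<Xi>_def ell2_nth_simps)
    then have "(norm \<Xi>)\<^sup>2 = (\<Sum>j\<in>G. (norm (u j) * norm e)\<^sup>2)"
      using norm_ell2_restrict [OF G, of \<Xi>] G by (simp add: \<Xi>_def ell2_nth_simps)
    also have "\<dots> \<le> t"
      unfolding t_def using mult_left_mono [OF norm_e norm_ge_zero] by (intro sum_mono power_mono) auto
    finally have norm_\<Xi>: "norm \<Xi> \<le> sqrt t"
      by (rule real_le_rsqrt)
    have Y_e: "Y i j (norm (u j) *\<^sub>R e) = u j" for j
    proof (cases "\<eta> = 0")
      case True
      then show ?thesis
        by (simp add: Y_def e_def u_def bounded_op_zero [OF bounded_op_adjoint_op [OF Xij]])
    next
      case False
      then have "cinner e e = 1"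
        by (simp add: cinner_self e_def norm_sgn)
      then have "Y i j (norm (u j) *\<^sub>R e) = norm (u j) *\<^sub>R sgn (u j)"
        by (simp add: Y_def cinner_scaleR_left flip: scaleR_eq_scaleC)
      then show ?thesis
        by (cases "u j = 0") (simp_all add: sgn_div_norm)
    qed
    have "cinner (Z \<Xi>) (ell2_single i \<eta>) = (\<Sum>j\<in>G. cinner (X i j (u j)) \<eta>)"
      by (simp add: \<Xi>_def Z.sum ell2_nth_sum cinner_sum_left cinner_ell2_single_right Z_single Y_e)
    also have "\<dots> = complex_of_real t"
      by (simp add: cinner_adjoint_op [OF Xij] flip: u_def) (simp add: cinner_self t_def)
    finally have "complex_of_real t = cinner (Z \<Xi>) (ell2_single i \<eta>)" ..
    moreover have "0 \<le> t"
      by (simp add: t_def sum_nonneg)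
    ultimately have "t = cmod (cinner (Z \<Xi>) (ell2_single i \<eta>))"
      by (metis norm_of_real abs_of_nonneg)
    also have "\<dots> \<le> norm (Z \<Xi>) * norm \<eta>"
      using cinner_cauchy_schwarz [of "Z \<Xi>" "ell2_single i \<eta>"] by (simp add: norm_ell2_single)
    also have "\<dots> \<le> (C * sqrt t) * norm \<eta>"
    proof (rule mult_right_mono)
      have "norm (Z \<Xi>) \<le> onorm Z * norm \<Xi>"
        by (rule bounded_op_norm_le [OF Z_op])
      also have "\<dots> \<le> C * sqrt t"
        using onorm_Z norm_\<Xi> \<open>0 \<le> C\<close> by (intro mult_mono) (auto simp: Z_def)
      finally show "norm (Z \<Xi>) \<le> C * sqrt t" .
    qed simp
    finally have "sqrt t * sqrt t \<le> sqrt t * (C * norm \<eta>)"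
      using \<open>0 \<le> t\<close> by (simp add: mult_ac)
    \<comment> \<open>One factor \<open>sqrt t\<close> is cancelled, with \<open>t = 0\<close>
      treated separately.\<close>
    then have "sqrt t \<le> C * norm \<eta>"
      using \<open>0 \<le> t\<close> \<open>0 \<le> C\<close> mult_le_cancel_left_pos [of "sqrt t" "sqrt t" "C * norm \<eta>"]
      by (cases "t = 0") (simp_all del: real_sqrt_mult_self)
    then have "t \<le> (C * norm \<eta>)\<^sup>2"
      by (rule sqrt_le_D)
    then show ?thesis
      by (simp add: t_def u_def power_mult_distrib)
  qed
  show ?thesis
    unfolding row_norm_eq_col_norm [OF X]
    using X \<open>0 \<le> C\<close> bound
    by (subst col_norm_le_iff) (auto simp: bounded_entries_def bounded_op_adjoint_op)
qed

section \<open>Diagonals of Gram matrices\<close>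

lemma op_of_matrix_diag:
  fixes T :: "('j, 'h::complex_hilbert) ell2 \<Rightarrow> ('j, 'h) ell2"
  assumes T: "bounded_op T"
  shows "op_of_matrix (diag_matrix (matrix_of_op T)) = ell2_diag \<circ> ell2_ampl T \<circ> ell2_embed"
    (is "_ = ?S")
proof (rule op_of_matrix_eqI)
  have "ell2_slice i (ell2_embed (ell2_single j \<xi>)) = (if i = j then ell2_single j \<xi> else 0)"
    for i j :: 'j and \<xi> :: 'h
    by (rule ell2_eqI) (simp add: ell2_ops_nth ell2_nth_simps)
  then have "matrix_of_op ?S = diag_matrix (matrix_of_op T)"
    by (auto simp: fun_eq_iff matrix_of_op_def diag_matrix_def ell2_diag.rep_eq ell2_nth_ampl [OF T]
        bounded_op_zero [OF T] ell2_nth_simps)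
  moreover have "bounded_op ?S"
    by (intro bounded_op_compose bounded_op_ell2_diag bounded_op_ell2_ampl bounded_op_ell2_embed T)
  ultimately show "represents_op (diag_matrix (matrix_of_op T)) ?S"
    by (simp add: represents_op_iff)
qed

context
  fixes T :: "('j, 'h::complex_hilbert) ell2 \<Rightarrow> ('j, 'h) ell2"
  assumes T: "bounded_op T"
begin

text \<open>One construction for both factors of (v): the operator of \<open>B\<close> as
  \<open>T\<close> gives \<open>diag(B^*B)\<close>, and the adjoint of the operator of
  \<open>A\<close> gives \<open>diag(AA^* )\<close>.\<close>

abbreviation gram_diag :: "('j, 'h) ell2 \<Rightarrow> ('j, 'h) ell2"
  where "gram_diag \<equiv> op_of_matrix (diag_matrix (matrix_of_op (adjoint_op T \<circ> T)))"

text \<open>Amplification is multiplicative, so \<open>T^* T \<otimes> I\<close> factors and the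
  outer adjoint moves to the second argument.\<close>

lemma cinner_gram_diag:
  "cinner (gram_diag x) y = cinner (ell2_ampl T (ell2_embed x)) (ell2_ampl T (ell2_embed y))"
proof -
  note T' = bounded_op_adjoint_op [OF T]
  have "ell2_ampl (adjoint_op T \<circ> T) \<Psi> = ell2_ampl (adjoint_op T) (ell2_ampl T \<Psi>)"
    for \<Psi> :: "('j \<times> 'j, 'h) ell2"
    by (rule ell2_eqI)
      (auto simp: split_paired_all ell2_nth_ampl ell2_slice_ampl T T' bounded_op_compose)
  then show ?thesis
    by (simp add: op_of_matrix_diag bounded_op_compose T T' cinner_ell2_diag cinner_ell2_ampl
        adjoint_op_adjoint_op)
qed

lemma inner_gram_diag: "inner (gram_diag x) x = (norm (ell2_ampl T (ell2_embed x)))\<^sup>2"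
  by (simp add: inner_eq_Re_cinner cinner_gram_diag cinner_self)

lemma positive_op_gram_diag: "positive_op gram_diag"
proof (rule positive_opI)
  show "bounded_op gram_diag"
    by (simp add: op_of_matrix_diag bounded_op_compose bounded_op_adjoint_op T bounded_op_ell2_diag
        bounded_op_ell2_ampl bounded_op_ell2_embed)
  show "cinner (gram_diag x) y = cinner x (gram_diag y)" for x y
    by (metis cinner_gram_diag cinner_commute)
qed (simp add: inner_gram_diag)

text \<open>Squared, both sides are the quadratic form of \<open>gram_diag\<close> at
  \<open>x\<close>. This turns \<open>cmod_cinner_schur_prod_le\<close> into (v).\<close>

lemma norm_sqrt_gram_diag: "norm (sqrt_op gram_diag x) = norm (ell2_ampl T (ell2_embed x))"
  using norm_sqrt_op_square [OF positive_op_gram_diag] by (simp add: inner_gram_diag)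

end

text \<open>The double adjoint is kept in the second equation so that its right side is a Gram
  matrix, with the adjoint in the role of \<open>T\<close>.\<close>

lemma
  fixes A :: "('j, 'h::complex_hilbert) op_matrix"
  assumes A: "bounded_matrix A"
  shows matrix_adj_prod: "matrix_adj A \<cdot>\<^sub>M A = matrix_of_op (adjoint_op (op_of_matrix A) \<circ> op_of_matrix A)"
    and matrix_prod_adj: "A \<cdot>\<^sub>M matrix_adj A
      = matrix_of_op (adjoint_op (adjoint_op (op_of_matrix A)) \<circ> adjoint_op (op_of_matrix A))"
  by (simp_all add: matrix_prod_def op_of_matrix_adj A adjoint_op_adjoint_op bounded_op_op_of_matrix)

text \<open>For the pair \<open>A^*\<close>, \<open>A\<close> both vectors in the flip formula
  coincide: \<open>S\<close> has the form \<open>cinner (ell2_flip (L x)) (L x)\<close> and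
  \<open>D\<close> has the form \<open>norm (L x)\<close> squared. The flip is symmetric and
  isometric, so its quadratic form lies between minus and plus the squared norm, which gives both
  inequalities.\<close>

lemma schur_prod_adj_le_gram_diag:
  fixes A :: "('j, 'h::complex_hilbert) op_matrix"
  assumes A: "bounded_matrix A"
  defines "S \<equiv> op_of_matrix (matrix_adj A \<box> A)"
    and "D \<equiv> op_of_matrix (diag_matrix (matrix_adj A \<cdot>\<^sub>M A))"
  shows "le_op (\<lambda>x. - D x) S" "le_op S D"
proof -
  note T = bounded_op_op_of_matrix [OF A]
  define L where "L = ell2_ampl (op_of_matrix A) \<circ> ell2_embed"
  have S: "cinner (S x) y = cinner (ell2_flip (L x)) (L y)" for x y
    by (simp add: S_def L_def cinner_schur_prod bounded_matrix_adj A op_of_matrix_adj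
        adjoint_op_adjoint_op T)
  have S_op: "bounded_op S"
    unfolding S_def by (intro bounded_op_op_of_matrix bounded_matrix_schur_prod bounded_matrix_adj A)
  have D_pos: "positive_op D"
    unfolding D_def matrix_adj_prod [OF A] by (rule positive_op_gram_diag [OF T])
  then have D_op: "bounded_op D"
    by (simp add: positive_op_def)
  have "inner (S x) x = inner (ell2_flip (L x)) (L x)" for x
    by (simp add: inner_eq_Re_cinner S)
  then have "\<bar>inner (S x) x\<bar> \<le> norm (L x) * norm (L x)" for x
    using Cauchy_Schwarz_ineq2 [of "ell2_flip (L x)" "L x"] by (simp add: norm_ell2_flip)
  moreover have "inner (D x) x = norm (L x) * norm (L x)" for x
    by (simp add: D_def L_def matrix_adj_prod [OF A] inner_gram_diag [OF T] power2_eq_square)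
  ultimately have SD: "\<bar>inner (S x) x\<bar> \<le> inner (D x) x" for x
    by simp
  have sym: "cinner (S x) y = cinner x (S y)" for x y
    by (metis S cinner_ell2_flip cinner_commute)
  show "le_op (\<lambda>x. - D x) S"
    unfolding le_op_def
  proof (rule positive_opI)
    show "0 \<le> inner (S x - - D x) x" for x
      using SD [of x] by (simp add: inner_add_left)
  qed (simp_all add: bounded_op_plus S_op D_op cinner_add_left cinner_add_right sym
      positive_op_symmetric [OF D_pos])
  show "le_op S D"
    unfolding le_op_def
  proof (rule positive_opI)
    show "0 \<le> inner (D x - S x) x" for x
      using SD [of x] by (simp add: inner_diff_left)
  qed (simp_all add: bounded_op_sub S_op D_op cinner_diff_left cinner_diff_right sym
      positive_op_symmetric [OF D_pos])
qed

theorem theorem2p9: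
  shows
    "\<comment> \<open>(i)\<close>
     (\<forall>A B :: ('j, 'h::complex_hilbert) op_matrix. bounded_matrix A \<longrightarrow> bounded_matrix B \<longrightarrow>
        bounded_matrix (A \<box> B) \<and>
        op_of_matrix (A \<box> B) = adjoint_op V_op \<circ> lambda_rep A \<circ> flip_op \<circ> lambda_rep B \<circ> V_op)
   \<and> \<comment> \<open>(ii)\<close>
     (\<forall>A B :: ('j, 'h) op_matrix. bounded_matrix A \<longrightarrow> bounded_matrix B \<longrightarrow>
        ennreal (onorm (op_of_matrix (A \<box> B))) \<le> row_norm A * col_norm B)
   \<and> \<comment> \<open>(iii)\<close>
     (\<forall>(X :: ('j, 'h) op_matrix) C. bounded_entries X \<longrightarrow> 0 \<le> C \<longrightarrow>
        (\<forall>Y :: ('j, 'h) op_matrix. bounded_entries Y \<longrightarrow> col_norm Y < \<infinity> \<longrightarrow>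
           bounded_matrix (X \<box> Y) \<and>
           ennreal (onorm (op_of_matrix (X \<box> Y))) \<le> ennreal C * col_norm Y) \<longrightarrow>
        row_norm X < \<infinity> \<and> row_norm X \<le> ennreal C)
   \<and> \<comment> \<open>(iv)\<close>
     (\<forall>A :: ('j, 'h) op_matrix. bounded_matrix A \<longrightarrow>
        le_op (\<lambda>\<Xi>. - op_of_matrix (diag_matrix (matrix_adj A \<cdot>\<^sub>M A)) \<Xi>)
              (op_of_matrix (matrix_adj A \<box> A)) \<and>
        le_op (op_of_matrix (matrix_adj A \<box> A))
              (op_of_matrix (diag_matrix (matrix_adj A \<cdot>\<^sub>M A))))
   \<and> \<comment> \<open>(v)\<close>
     (\<forall>(\<Xi> :: ('j, 'h) ell2) \<Gamma> (A :: ('j, 'h) op_matrix) B. bounded_matrix A \<longrightarrow> bounded_matrix B \<longrightarrow>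
        cmod (cinner (op_of_matrix (A \<box> B) \<Xi>) \<Gamma>)
          \<le> norm (sqrt_op (op_of_matrix (diag_matrix (matrix_adj B \<cdot>\<^sub>M B))) \<Xi>)
            * norm (sqrt_op (op_of_matrix (diag_matrix (A \<cdot>\<^sub>M matrix_adj A))) \<Gamma>))"
proof (intro conjI allI impI)
  fix A B :: "('j, 'h) op_matrix"
  assume AB: "bounded_matrix A" "bounded_matrix B"
  then show "bounded_matrix (A \<box> B)"
    "op_of_matrix (A \<box> B) = adjoint_op V_op \<circ> lambda_rep A \<circ> flip_op \<circ> lambda_rep B \<circ> V_op"
    "ennreal (onorm (op_of_matrix (A \<box> B))) \<le> row_norm A * col_norm B"
    by (rule bounded_matrix_schur_prod op_of_matrix_schur_prod onorm_schur_prod_le; assumption)+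
  fix \<Xi> \<Gamma>
  show "cmod (cinner (op_of_matrix (A \<box> B) \<Xi>) \<Gamma>)
      \<le> norm (sqrt_op (op_of_matrix (diag_matrix (matrix_adj B \<cdot>\<^sub>M B))) \<Xi>)
        * norm (sqrt_op (op_of_matrix (diag_matrix (A \<cdot>\<^sub>M matrix_adj A))) \<Gamma>)"
    using cmod_cinner_schur_prod_le [OF AB]
    by (simp add: matrix_adj_prod matrix_prod_adj norm_sqrt_gram_diag bounded_op_adjoint_op
        bounded_op_op_of_matrix AB)
next
  fix X :: "('j, 'h) op_matrix" and C :: real
  assume "bounded_entries X" "0 \<le> C"
    "\<forall>Y :: ('j, 'h) op_matrix. bounded_entries Y \<longrightarrow> col_norm Y < \<infinity> \<longrightarrow>
      bounded_matrix (X \<box> Y) \<and> ennreal (onorm (op_of_matrix (X \<box> Y))) \<le> ennreal C * col_norm Y"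
  then show le: "row_norm X \<le> ennreal C"
    by (intro row_norm_le_of_schur_multiplier) auto
  then show "row_norm X < \<infinity>"
    by (rule le_less_trans) simp
next
  fix A :: "('j, 'h) op_matrix"
  assume "bounded_matrix A"
  then show "le_op (\<lambda>\<Xi>. - op_of_matrix (diag_matrix (matrix_adj A \<cdot>\<^sub>M A)) \<Xi>)
      (op_of_matrix (matrix_adj A \<box> A))"
    "le_op (op_of_matrix (matrix_adj A \<box> A)) (op_of_matrix (diag_matrix (matrix_adj A \<cdot>\<^sub>M A)))"
    by (rule schur_prod_adj_le_gram_diag)+
qed

end
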